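(* Let $\mathscr E$ be a pure exchange economy with asymmetric information (as defined in the context) satisfying (A$_1$), (A$_2$), (A$_3$) and (A$_4$). Then the ex-post core $\mathbf C(\mathscr E)$ is not empty. Moreover, $$\mathbf C(\mathscr E)=\left\{ f : f \text{ is an allocation in } \mathscr E \text{ and } f(\cdot,\omega)\in \mathbf C(\mathscr E(\omega)) \text{ for all } \omega\in\Omega\right\}.$$
   Context: Economy. $\mathscr E = \{(\Omega,\mathscr F,\mathbb P);(T,\Sigma,\mu);\mathbb R^\ell_+;(\mathscr F_t,U(t,\cdot,\cdot),a(t,\cdot),\mathbb P_t)_{t\in T}\}$, where $(\Omega,\mathscr F,\mathbb P)$ is a complete probability space (states of nature), $(T,\Sigma,\mu)$ is a complete, finite, positive measure space of agents (it may have atoms), and $\mathbb R^\ell_+$ is the consumption set of each agent in each state. Agent $t$ has: private information $\mathscr F_t$, the $\sigma$-algebra generated by a measurable partition $\Pi_t$ of $\Omega$; a state-dependent utility $U(t,\cdot,\cdot):\Omega\times\mathbb R^\ell_+\to\mathbb R$; a state-dependent initial endowment $a(t,\cdot):\Omega\to\mathbb R^\ell_+$; a prior $\mathbb P_t$, a probability measure on $\mathscr F$. For $x,y\in\mathbb R^\ell$: $x\le y$ is the coordinatewise order, $x<y$ means $x\le y$ and $x\ne y$, $x\ll y$ means $x_k<y_k$ for all $k$. A function $u:\mathbb R^\ell_+\to\mathbb R$ is strictly increasing if $u(x)<u(y)$ whenever $x<y$; it is strictly quasi-concave if $u(\alpha x+(1-\alpha)y)>\min\{u(x),u(y)\}$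 for all $x\neq y$ and $0<\alpha<1$. Assumptions. (A$_1$) $a:T\times\Omega\to\mathbb R^\ell_+$ is $\Sigma\otimes\mathscr F$-measurable, $a(\cdot,\omega)$ is (Bochner) integrable and $\int_T a(\cdot,\omega)\,d\mu\gg0$ for each $\omega\in\Omega$. (A$_2$) $U(\cdot,\cdot,x)$ is $\Sigma\otimes\mathscr F$-measurable for all $x\in\mathbb R^\ell_+$. (A$_3$) $U(t,\omega,\cdot)$ is continuous and strictly increasing for each $(t,\omega)\in T\times\Omega$. (A$_4$) $U(t,\omega,\cdot)$ is strictly quasi-concave for each $(t,\omega)\in T\times\Omega$. A coalition is a set $S\in\Sigma$ with $\mu(S)>0$. An assignment is a function $f:T\times\Omega\to\mathbb R^\ell_+$ such that $f(\cdot,\omega)\in L_1(\mu,\mathbb R^\ell)$ for every $\omega\in\Omega$ and $f(t,\cdot)$ is $\mathscr F$-measurable for every $t\in T$. An allocation is an assignment $f$ with $\int_T f(\cdot,\omega)\,d\mu=\int_T a(\cdot,\omega)\,d\mu$ for every $\omega\in\Omega$. Ex-post core. An allocation $f$ is ex-post blocked by a coalition $S$ if there exist a state $\omega_0\in\Omega$ and an assignment $g$ such that (i) $\int_S g(\cdot,\omega_0)\,d\mu=\int_S a(\cdot,\omega_0)\,d\mu$ and (ii) $U(t,\omega_0,g(t,\omega_0))>U(t,\omega_0,f(t,\omega_0))$ $\mu$-a.e. on $S$. The ex-post core $\mathbf C(\mathscr E)$ is the set of all allocations that are not ex-post blocked by any coalition. For $\omega\in\Omega$, $\mathscr E(\omega)=\{(T,\Sigma,\mu);\mathbb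 R^\ell_+;(U(t,\omega,\cdot),a(t,\omega))_{t\in T}\}$ is the complete information economy at $\omega$. Its core $\mathbf C(\mathscr E(\omega))$ is the set of integrable $f:T\to\mathbb R^\ell_+$ with $\int_T f\,d\mu=\int_T a(\cdot,\omega)\,d\mu$ for which there are no coalition $S$ and integrable $g:T\to\mathbb R^\ell_+$ with $\int_S g\,d\mu=\int_S a(\cdot,\omega)\,d\mu$ and $U(t,\omega,g(t))>U(t,\omega,f(t))$ $\mu$-a.e. on $S$. *)

theory Defs
  imports "HOL-Probability.Probability"
begin

text \<open>
  On \<^typ>\<open>real ^ 'n\<close> the library order \<open>x \<le> y\<close> is coordinatewise and \<open>x < y\<close> means
  \<open>x \<le> y \<and> x \<noteq> y\<close>.
\<close>

definition strongly_less :: "real ^ 'n \<Rightarrow> real ^ 'n \<Rightarrow> bool"  (infix "\<lless>" 50) where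
  "x \<lless> y \<longleftrightarrow> (\<forall>k. x $ k < y $ k)"

definition orthant :: "(real ^ 'n) set" where
  "orthant = {x. 0 \<le> x}"

definition strictly_quasi_concave_on :: "(real ^ 'n) set \<Rightarrow> (real ^ 'n \<Rightarrow> real) \<Rightarrow> bool" where
  "strictly_quasi_concave_on C u \<longleftrightarrow>
     (\<forall>x\<in>C. \<forall>y\<in>C. \<forall>\<alpha>. x \<noteq> y \<and> 0 < \<alpha> \<and> \<alpha> < 1 \<longrightarrow>
        u (\<alpha> *\<^sub>R x + (1 - \<alpha>) *\<^sub>R y) > min (u x) (u y))"

text \<open>
  Functions on \<open>T\<close>, \<open>\<Omega>\<close> and the orthant are total HOL functions whose values outside the
  intended domain are arbitrary; every condition below is relativised to that domain.
\<close>

record ('t, 'w, 'n) economy =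
  states :: "'w measure"
  agents :: "'t measure"
  info   :: "'t \<Rightarrow> 'w set set"
  util   :: "'t \<Rightarrow> 'w \<Rightarrow> real ^ 'n \<Rightarrow> real"
  endow  :: "'t \<Rightarrow> 'w \<Rightarrow> real ^ 'n"
  prior  :: "'t \<Rightarrow> 'w measure"

text \<open>
  The partition generating \<open>info E t\<close> consists of measurable sets but is not required to be
  countable.
\<close>

definition is_economy :: "('t, 'w, 'n::finite) economy \<Rightarrow> bool" where
  "is_economy E \<longleftrightarrow>
     prob_space (states E) \<and> complete_measure (states E) \<and>
     finite_measure (agents E) \<and> complete_measure (agents E) \<and>
     (\<forall>t\<in>space (agents E).
        (\<exists>Q. partition_on (space (states E)) Q \<and> Q \<subseteq> sets (states E) \<and>
             info E t = sigma_sets (space (states E)) Q) \<and>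
        (\<forall>\<omega>\<in>space (states E). endow E t \<omega> \<in> orthant) \<and>
        prob_space (prior E t) \<and> sets (prior E t) = sets (states E))"

definition A1 :: "('t, 'w, 'n::finite) economy \<Rightarrow> bool" where
  "A1 E \<longleftrightarrow>
     (\<lambda>(t, \<omega>). endow E t \<omega>) \<in> borel_measurable (agents E \<Otimes>\<^sub>M states E) \<and>
     (\<forall>\<omega>\<in>space (states E).
        integrable (agents E) (\<lambda>t. endow E t \<omega>) \<and>
        0 \<lless> (LINT t|agents E. endow E t \<omega>))"

definition A2 :: "('t, 'w, 'n::finite) economy \<Rightarrow> bool" where
  "A2 E \<longleftrightarrow>
     (\<forall>x\<in>orthant. (\<lambda>(t, \<omega>). util E t \<omega> x) \<in> borel_measurable (agents E \<Otimes>\<^sub>M states E))"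

definition A3 :: "('t, 'w, 'n::finite) economy \<Rightarrow> bool" where
  "A3 E \<longleftrightarrow>
     (\<forall>t\<in>space (agents E). \<forall>\<omega>\<in>space (states E).
        continuous_on orthant (util E t \<omega>) \<and> strict_mono_on orthant (util E t \<omega>))"

definition A4 :: "('t, 'w, 'n::finite) economy \<Rightarrow> bool" where
  "A4 E \<longleftrightarrow>
     (\<forall>t\<in>space (agents E). \<forall>\<omega>\<in>space (states E).
        strictly_quasi_concave_on orthant (util E t \<omega>))"

definition coalition :: "'t measure \<Rightarrow> 't set \<Rightarrow> bool" where
  "coalition M S \<longleftrightarrow> S \<in> sets M \<and> emeasure M S > 0"

definition assignment :: "('t, 'w, 'n::finite) economy \<Rightarrow> ('t \<Rightarrow> 'w \<Rightarrow> real ^ 'n) \<Rightarrow> bool" where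
  "assignment E f \<longleftrightarrow>
     (\<forall>t\<in>space (agents E). \<forall>\<omega>\<in>space (states E). f t \<omega> \<in> orthant) \<and>
     (\<forall>\<omega>\<in>space (states E). integrable (agents E) (\<lambda>t. f t \<omega>)) \<and>
     (\<forall>t\<in>space (agents E). f t \<in> borel_measurable (states E))"

definition allocation :: "('t, 'w, 'n::finite) economy \<Rightarrow> ('t \<Rightarrow> 'w \<Rightarrow> real ^ 'n) \<Rightarrow> bool" where
  "allocation E f \<longleftrightarrow>
     assignment E f \<and>
     (\<forall>\<omega>\<in>space (states E). (LINT t|agents E. f t \<omega>) = (LINT t|agents E. endow E t \<omega>))"

definition ex_post_blocked ::
    "('t, 'w, 'n::finite) economy \<Rightarrow> ('t \<Rightarrow> 'w \<Rightarrow> real ^ 'n) \<Rightarrow> 't set \<Rightarrow> bool" where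
  "ex_post_blocked E f S \<longleftrightarrow>
     (\<exists>\<omega>\<^sub>0\<in>space (states E). \<exists>g. assignment E g \<and>
        (LINT t:S|agents E. g t \<omega>\<^sub>0) = (LINT t:S|agents E. endow E t \<omega>\<^sub>0) \<and>
        (AE t in agents E. t \<in> S \<longrightarrow> util E t \<omega>\<^sub>0 (g t \<omega>\<^sub>0) > util E t \<omega>\<^sub>0 (f t \<omega>\<^sub>0)))"

definition ex_post_core :: "('t, 'w, 'n::finite) economy \<Rightarrow> ('t \<Rightarrow> 'w \<Rightarrow> real ^ 'n) set" where
  "ex_post_core E =
     {f. allocation E f \<and> \<not> (\<exists>S. coalition (agents E) S \<and> ex_post_blocked E f S)}"

text \<open>The prefix \<open>ci\<close> stands for complete information.\<close>

record ('t, 'n) ci_economy =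
  ci_agents :: "'t measure"
  ci_util   :: "'t \<Rightarrow> real ^ 'n \<Rightarrow> real"
  ci_endow  :: "'t \<Rightarrow> real ^ 'n"

definition economy_at :: "('t, 'w, 'n::finite) economy \<Rightarrow> 'w \<Rightarrow> ('t, 'n) ci_economy" where
  "economy_at E \<omega> =
     \<lparr> ci_agents = agents E, ci_util = (\<lambda>t. util E t \<omega>), ci_endow = (\<lambda>t. endow E t \<omega>) \<rparr>"

definition ci_assignment :: "('t, 'n::finite) ci_economy \<Rightarrow> ('t \<Rightarrow> real ^ 'n) \<Rightarrow> bool" where
  "ci_assignment D f \<longleftrightarrow>
     (\<forall>t\<in>space (ci_agents D). f t \<in> orthant) \<and> integrable (ci_agents D) f"

definition ci_core :: "('t, 'n::finite) ci_economy \<Rightarrow> ('t \<Rightarrow> real ^ 'n) set" where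
  "ci_core D =
     {f. ci_assignment D f \<and>
         (LINT t|ci_agents D. f t) = (LINT t|ci_agents D. ci_endow D t) \<and>
         \<not> (\<exists>S g. coalition (ci_agents D) S \<and> ci_assignment D g \<and>
              (LINT t:S|ci_agents D. g t) = (LINT t:S|ci_agents D. ci_endow D t) \<and>
              (AE t in ci_agents D. t \<in> S \<longrightarrow> ci_util D t (g t) > ci_util D t (f t)))}"

end

theory Submission
  imports Defs
begin

text \<open>
  In each state \<open>\<omega>\<close> a Walrasian equilibrium lies in the core of the economy at \<open>\<omega>\<close>. Strict
  quasi-concavity makes demand single-valued, hence continuous in prices, so an equilibrium price
  is a zero of the continuous mean excess demand; it comes from Brouwer's theorem on simplices
  truncated away from the boundary, with Fatou's lemma keeping the limit price strictly positive.
  Mean excess demand is a Caratheodory function of state and price, so its zero \<open>p \<omega>\<close> can be selected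
  measurably in \<open>\<omega>\<close>; demand at \<open>p \<omega>\<close> is then an allocation that is in the core in every state.
\<close>

section \<open>Measurable selection\<close>

text \<open>Nonemptiness of every state core alone gives no allocation: an assignment must be
  measurable in the state for each agent, so the equilibria of different states have to be chosen
  coherently. Choosing a price is enough, because demand is a function of the price and of the
  measurable data of the agent. One measurability statement for demand serves on three spaces:
  agents (to integrate demand), states (to obtain an assignment) and their product (to make mean
  excess demand measurable in the state).

  Since there may be atoms, averaging over agents cannot be relied on to convexify; single-valued
  individual demand is what puts Brouwer's theorem within reach.

  Maximisers are available only at strictly positive prices, which in general form no compact set
  even after normalisation. Existence and selection therefore both use compact simplices whose price
  floors decrease to 0: existence passes to the limit along them, while selection stops at the first
  one that contains a zero.\<close>

lemma dense_sequence:
  fixes X :: "'b::{metric_space, second_countable_topology} set"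
  assumes "X \<noteq> {}"
  obtains d :: "nat \<Rightarrow> 'b"
  where "range d \<subseteq> X" and "\<And>y e. y \<in> X \<Longrightarrow> e > 0 \<Longrightarrow> \<exists>n. dist (d n) y < e"
proof -
  obtain T where T: "countable T" "T \<subseteq> X" "X \<subseteq> closure T"
    using separable by blast
  with assms have "T \<noteq> {}" by auto
  then have r: "range (from_nat_into T) = T"
    using T(1) by (rule range_from_nat_into)
  show thesis
  proof
    show "range (from_nat_into T) \<subseteq> X" using r T by simp
    fix y and e :: real assume "y \<in> X" "e > 0"
    then obtain z where "z \<in> T" "dist z y < e"
      using T(3) closure_approachable by blast
    then show "\<exists>n. dist (from_nat_into T n) y < e" using r by (metis imageE)
  qed
qed

text \<open>Replacing \<open>h x\<close> by the first point of a dense sequence within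
  \<open>1 / Suc k\<close> of it leaves only countably many values, so measurability of each
  \<open>u x y\<close> in \<open>x\<close> suffices; continuity in \<open>y\<close> passes to the
  limit in \<open>k\<close>.\<close>

lemma borel_measurable_Caratheodory:
  fixes X :: "'b::{metric_space, second_countable_topology} set"
    and u :: "'a \<Rightarrow> 'b \<Rightarrow> 'c::metric_space"
  assumes u: "\<And>y. y \<in> X \<Longrightarrow> (\<lambda>x. u x y) \<in> borel_measurable M"
    and cont: "\<And>x. x \<in> space M \<Longrightarrow> continuous_on X (u x)"
    and h[measurable]: "h \<in> borel_measurable M"
    and hX: "\<And>x. x \<in> space M \<Longrightarrow> h x \<in> X"
  shows "(\<lambda>x. u x (h x)) \<in> borel_measurable M"
proof (cases "X = {}")
  case True
  then have "space M = {}" using hX by auto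
  then show ?thesis by (simp add: measurable_def)
next
  case False
  then obtain d :: "nat \<Rightarrow> 'b" where d: "range d \<subseteq> X"
    and dense: "\<And>y e. y \<in> X \<Longrightarrow> e > 0 \<Longrightarrow> \<exists>n. dist (d n) y < e"
    using dense_sequence by blast
  define N where "N k x = (LEAST n. dist (d n) (h x) < 1 / real (Suc k))" for k x
  have N[measurable]: "N k \<in> measurable M (count_space UNIV)" for k
    unfolding N_def by measurable
  have near: "dist (d (N k x)) (h x) < 1 / real (Suc k)" if "x \<in> space M" for k x
    unfolding N_def by (rule LeastI_ex[OF dense[OF hX[OF that]]]) simp
  show ?thesis
  proof (rule borel_measurable_LIMSEQ_metric)
    show "(\<lambda>x. u x (d (N k x))) \<in> borel_measurable M" for k
      by (rule measurable_compose_countable[OF u N]) (use d in auto)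
    fix x assume x: "x \<in> space M"
    have "(\<lambda>k. 1 / real (Suc k)) \<longlonglongrightarrow> 0"
      by (rule LIMSEQ_Suc[OF lim_1_over_n])
    then have "(\<lambda>k. dist (d (N k x)) (h x)) \<longlonglongrightarrow> 0"
      by (rule tendsto_sandwich[OF _ _ tendsto_const, rotated 2]) (simp_all add: less_imp_le[OF near[OF x]] del: of_nat_Suc)
    then have "(\<lambda>k. d (N k x)) \<longlonglongrightarrow> h x"
      by (rule tendsto_dist_iff[THEN iffD2])
    then show "(\<lambda>k. u x (d (N k x))) \<longlonglongrightarrow> u x (h x)"
      by (rule continuous_on_tendsto_compose[OF cont[OF x] _ hX[OF x]])
        (use d in \<open>intro always_eventually, auto\<close>)
  qed
qed

text \<open>A selection theorem of Kuratowski--Ryll-Nardzewski type: for \<open>k = 0, 1, \<dots>\<close> the set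
  \<open>A x\<close> is cut down by the first ball it meets in a countable cover by balls of radius \<open>1 / Suc k\<close>.\<close>

lemma measurable_selection:
  fixes A :: "'a \<Rightarrow> 'b::polish_space set"
  assumes closed: "\<And>x. x \<in> space M \<Longrightarrow> closed (A x)"
    and ne: "\<And>x. x \<in> space M \<Longrightarrow> A x \<noteq> {}"
    and hit: "\<And>C. closed C \<Longrightarrow> Measurable.pred M (\<lambda>x. A x \<inter> C \<noteq> {})"
  obtains s where "s \<in> borel_measurable M" and "\<And>x. x \<in> space M \<Longrightarrow> s x \<in> A x"
proof -
  obtain d :: "nat \<Rightarrow> 'b" where d: "\<And>y e. e > 0 \<Longrightarrow> \<exists>n. dist (d n) y < e"
    using dense_sequence[of "UNIV :: 'b set"] by auto
  define C where "C k n = cball (d n) (1 / real (Suc k))" for k n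
  define B where "B = rec_nat A (\<lambda>k B x. B x \<inter> C k (LEAST n. B x \<inter> C k n \<noteq> {}))"
  have B0: "B 0 = A" and
    BSuc: "B (Suc k) x = B k x \<inter> C k (LEAST n. B k x \<inter> C k n \<noteq> {})" for k x
    by (auto simp: B_def)
  have meets: "\<exists>n. Y \<inter> C k n \<noteq> {}" if "Y \<noteq> {}" for Y k
  proof -
    from that obtain y where y: "y \<in> Y" by blast
    obtain n where "dist (d n) y < 1 / real (Suc k)" using d[of "1 / real (Suc k)" y] by auto
    then have "y \<in> Y \<inter> C k n" using y by (simp add: C_def)
    then show ?thesis by blast
  qed
  have Bne: "B k x \<noteq> {}" if "x \<in> space M" for k x
  proof (induction k)
    case 0 then show ?case using ne that by (simp add: B0)
  next
    case (Suc k)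
    show ?case unfolding BSuc by (rule LeastI_ex[OF meets[OF Suc]])
  qed
  have Bclosed: "closed (B k x)" if "x \<in> space M" for k x
    by (induction k) (use closed that in \<open>auto simp: B0 BSuc C_def\<close>)
  have Bhit: "Measurable.pred M (\<lambda>x. B k x \<inter> F \<noteq> {})" if "closed F" for k F
    using that
  proof (induction k arbitrary: F)
    case 0 then show ?case using hit by (simp add: B0)
  next
    case (Suc k)
    have N: "(\<lambda>x. LEAST n. B k x \<inter> C k n \<noteq> {}) \<in> measurable M (count_space UNIV)"
      by (rule measurable_Least) (rule Suc.IH, simp add: C_def)
    \<comment> \<open>For a fixed ball index \<open>n\<close> the set to be hit is again closed, so
      the induction hypothesis, kept general in \<open>F\<close>, applies. The measurable index
      \<open>N\<close> then lets \<open>n\<close> depend on \<open>x\<close>.\<close>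
    have "Measurable.pred M (\<lambda>x. B k x \<inter> (C k n \<inter> F) \<noteq> {})" for n
      by (rule Suc.IH) (use Suc.prems in \<open>simp add: C_def closed_Int\<close>)
    from measurable_compose_countable[OF this N] show ?case
      unfolding BSuc Int_assoc .
  qed
  have diam: "dist y z \<le> 2 / real (Suc k)" if yz: "y \<in> B (Suc k) x" "z \<in> B (Suc k) x" for k x y z
  proof -
    obtain n where "y \<in> C k n" "z \<in> C k n" using yz unfolding BSuc by blast
    then have "dist y z \<le> 1 / real (Suc k) + 1 / real (Suc k)"
      using dist_triangle2[of y z "d n"] by (simp add: C_def dist_commute)
    then show ?thesis by simp
  qed
  have small: "\<exists>k. 2 / real (Suc k) < e" if e: "e > 0" for e :: real
  proof -
    obtain n where "inverse (real (Suc n)) < e / 2" using reals_Archimedean[of "e/2"] e by auto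
    then show ?thesis by (auto simp: field_simps intro!: exI[of _ n])
  qed
  have "\<exists>y. \<forall>k. y \<in> B k x" if x: "x \<in> space M" for x
  proof -
    have "antimono (\<lambda>k. B k x)" by (rule decseq_SucI) (auto simp: BSuc)
    then have anti: "B n x \<subseteq> B m x" if "m \<le> n" for m n using that by (auto dest: antimonoD)
    show ?thesis
    \<comment> \<open>Completeness enters here: nested closed nonempty sets whose diameters tend to
      0 have a common point.\<close>
    proof (rule decreasing_closed_nest[of "\<lambda>k. B k x"])
      fix e :: real assume "e > 0"
      then obtain k where "2 / real (Suc k) < e" using small by blast
      then have "\<forall>y\<in>B (Suc k) x. \<forall>z\<in>B (Suc k) x. dist y z < e" using diam by fastforce
      then show "\<exists>n. \<forall>y\<in>B n x. \<forall>z\<in>B n x. dist y z < e" by blast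
    qed (use Bclosed Bne x anti in blast)+
  qed
  then obtain s where s: "\<And>x k. x \<in> space M \<Longrightarrow> s x \<in> B k x" by metis
  \<comment> \<open>As the \<open>B k x\<close> shrink to \<open>s x\<close>, membership in a closed
    set becomes countably many hitting conditions, each already known to be measurable.\<close>
  have char: "s x \<in> F \<longleftrightarrow> (\<forall>k. B k x \<inter> F \<noteq> {})" if x: "x \<in> space M" and F: "closed F" for x F
  proof
    assume "s x \<in> F" then show "\<forall>k. B k x \<inter> F \<noteq> {}" using s x by blast
  next
    assume *: "\<forall>k. B k x \<inter> F \<noteq> {}"
    have "\<exists>y\<in>F. dist y (s x) < e" if e: "e > 0" for e
    proof -
      obtain k where k: "2 / real (Suc k) < e" using small e by blast
      obtain y where "y \<in> B (Suc k) x" "y \<in> F" using * by blast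
      then show ?thesis using diam[of y k x "s x"] s[OF x, of "Suc k"] k by force
    qed
    then show "s x \<in> F" using F closed_approachable by blast
  qed
  have cl: "s -` F \<inter> space M \<in> sets M" if "closed F" for F
  proof -
    have "Measurable.pred M (\<lambda>x. \<forall>k. B k x \<inter> F \<noteq> {})"
      by (intro pred_intros_countable Bhit that)
    moreover have "s -` F \<inter> space M = {x\<in>space M. \<forall>k. B k x \<inter> F \<noteq> {}}"
      using char that by blast
    ultimately show ?thesis by (simp add: pred_def)
  qed
  show thesis
  proof
    show "s \<in> borel_measurable M"
    proof (rule borel_measurableI)
      fix S :: "'b set" assume "open S"
      have "s -` S \<inter> space M = space M - (s -` (- S) \<inter> space M)" by auto
      then show "s -` S \<inter> space M \<in> sets M" using cl[of "- S"] \<open>open S\<close> by auto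
    qed
    show "s x \<in> A x" if "x \<in> space M" for x using s[OF that, of 0] by (simp add: B0)
  qed
qed

text \<open>The set of maximisers meets a closed \<open>C\<close> exactly when the maximum over
  \<open>K \<inter> C\<close> attains the maximum over \<open>K\<close>. With \<open>d\<close> dense
  in \<open>K\<close> and \<open>e\<close> dense in \<open>K \<inter> C\<close> this becomes a
  countable condition; the slack \<open>1 / Suc k\<close> is there because the maximum need not be
  attained along \<open>e\<close>.\<close>

lemma measurable_maximizer:
  fixes K :: "'b::polish_space set" and v :: "'a \<Rightarrow> 'b \<Rightarrow> real"
  assumes K: "compact K" "K \<noteq> {}"
    and meas: "\<And>y. y \<in> K \<Longrightarrow> (\<lambda>x. v x y) \<in> borel_measurable M"
    and cont: "\<And>x. x \<in> space M \<Longrightarrow> continuous_on K (v x)"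
  obtains s where "s \<in> borel_measurable M"
    and "\<And>x. x \<in> space M \<Longrightarrow> s x \<in> K \<and> (\<forall>y\<in>K. v x y \<le> v x (s x))"
proof -
  define A where "A x = {z\<in>K. \<forall>y\<in>K. v x y \<le> v x z}" for x
  have approx: "\<exists>n. \<bar>v x (e n) - v x y\<bar> < r"
    if "x \<in> space M" "L \<subseteq> K" "y \<in> L" "r > 0" "range e \<subseteq> L"
      and dense: "\<And>y r. y \<in> L \<Longrightarrow> r > 0 \<Longrightarrow> \<exists>n. dist (e n) y < r"
    for x L y r and e :: "nat \<Rightarrow> 'b"
  proof -
    have "continuous_on L (v x)" using cont that continuous_on_subset by blast
    then obtain \<delta> where "\<delta> > 0" "\<forall>z\<in>L. dist z y < \<delta> \<longrightarrow> dist (v x z) (v x y) < r"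
      unfolding continuous_on_iff using \<open>y \<in> L\<close> \<open>r > 0\<close> by blast
    moreover obtain n where "dist (e n) y < \<delta>" using dense \<open>y \<in> L\<close> \<open>\<delta> > 0\<close> by blast
    moreover have "e n \<in> L" using \<open>range e \<subseteq> L\<close> by auto
    ultimately show ?thesis unfolding dist_real_def by blast
  qed
  have hit: "Measurable.pred M (\<lambda>x. A x \<inter> C \<noteq> {})" if C: "closed C" for C
  proof (cases "K \<inter> C = {}")
    case True
    then have "\<And>x. A x \<inter> C = {}" by (auto simp: A_def)
    then show ?thesis by simp
  next
    case False
    obtain d :: "nat \<Rightarrow> 'b" where d: "range d \<subseteq> K"
      "\<And>y e. y \<in> K \<Longrightarrow> e > 0 \<Longrightarrow> \<exists>n. dist (d n) y < e"
      using dense_sequence[OF K(2)] by blast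
    obtain e :: "nat \<Rightarrow> 'b" where e: "range e \<subseteq> K \<inter> C"
      "\<And>y r. y \<in> K \<inter> C \<Longrightarrow> r > 0 \<Longrightarrow> \<exists>n. dist (e n) y < r"
      using dense_sequence[OF False] by blast
    have de: "d n \<in> K" "e n \<in> K" for n using d e by auto
    have [measurable]: "(\<lambda>x. v x (d n)) \<in> borel_measurable M" "(\<lambda>x. v x (e n)) \<in> borel_measurable M"
      for n using de meas by blast+
    have "A x \<inter> C \<noteq> {} \<longleftrightarrow> (\<forall>n k. \<exists>m. v x (e m) > v x (d n) - 1 / real (Suc k))"
      if x: "x \<in> space M" for x
    proof
      assume "A x \<inter> C \<noteq> {}"
      then obtain z where z: "z \<in> K \<inter> C" "\<And>y. y \<in> K \<Longrightarrow> v x y \<le> v x z" by (auto simp: A_def)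
      show "\<forall>n k. \<exists>m. v x (e m) > v x (d n) - 1 / real (Suc k)"
      proof (intro allI)
        fix n k
        obtain m where "\<bar>v x (e m) - v x z\<bar> < 1 / real (Suc k)"
          using approx[OF x _ z(1) _ e, of "1 / real (Suc k)"] by auto
        then show "\<exists>m. v x (e m) > v x (d n) - 1 / real (Suc k)"
          using z(2)[OF de(1)[of n]] by (intro exI[of _ m]) linarith
      qed
    next
      assume *: "\<forall>n k. \<exists>m. v x (e m) > v x (d n) - 1 / real (Suc k)"
      have "compact (K \<inter> C)" using K C by (simp add: compact_Int_closed)
      then obtain z where z: "z \<in> K \<inter> C" "\<And>y. y \<in> K \<inter> C \<Longrightarrow> v x y \<le> v x z"
        using continuous_attains_sup[of "K \<inter> C" "v x"] False
          continuous_on_subset[OF cont[OF x]] by (metis inf_le1)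
      have dz: "v x (d n) \<le> v x z" for n
      proof (rule field_le_epsilon)
        fix r :: real assume "r > 0"
        then obtain k where k: "inverse (real (Suc k)) < r" using reals_Archimedean by blast
        obtain m where "v x (e m) > v x (d n) - 1 / real (Suc k)" using * by blast
        moreover have "e m \<in> K \<inter> C" using e(1) by blast
        ultimately show "v x (d n) \<le> v x z + r"
          using z(2)[of "e m"] k by (auto simp: inverse_eq_divide)
      qed
      have "v x y \<le> v x z" if y: "y \<in> K" for y
      proof (rule field_le_epsilon)
        fix r :: real assume "r > 0"
        then obtain n where "\<bar>v x (d n) - v x y\<bar> < r"
          using approx[OF x subset_refl y _ d] by blast
        then show "v x y \<le> v x z + r" using dz[of n] by linarith
      qed
      then show "A x \<inter> C \<noteq> {}" using z(1) by (auto simp: A_def)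
    qed
    then have "Measurable.pred M (\<lambda>x. A x \<inter> C \<noteq> {}) \<longleftrightarrow>
        Measurable.pred M (\<lambda>x. \<forall>n k. \<exists>m. v x (e m) > v x (d n) - 1 / real (Suc k))"
      by (intro measurable_cong) simp
    then show ?thesis by simp
  qed
  have "closed (A x)" if x: "x \<in> space M" for x
  proof -
    have "A x = (\<Inter>y\<in>K. {z\<in>K. v x y \<le> v x z})" using K by (auto simp: A_def)
    moreover have "closed {z\<in>K. v x y \<le> v x z}" for y
      using continuous_on_closed_Collect_le[OF continuous_on_const cont[OF x] compact_imp_closed[OF K(1)]] .
    ultimately show ?thesis by auto
  qed
  moreover have "A x \<noteq> {}" if x: "x \<in> space M" for x
    using continuous_attains_sup[OF K cont[OF x]] by (auto simp: A_def)
  ultimately obtain s where "s \<in> borel_measurable M" "\<And>x. x \<in> space M \<Longrightarrow> s x \<in> A x"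
    using measurable_selection[of M A] hit by metis
  then show thesis using that unfolding A_def by blast
qed

section \<open>Demand\<close>

lemma orthant_iff: "x \<in> orthant \<longleftrightarrow> (\<forall>i. 0 \<le> x $ i)"
  by (simp add: orthant_def less_eq_vec_def)

lemma closed_orthant: "closed (orthant :: (real ^ 'n::finite) set)"
  unfolding orthant_def less_eq_vec_def
  by (intro closed_Collect_all closed_Collect_le continuous_intros)

lemma zero_in_orthant: "0 \<in> orthant"
  by (simp add: orthant_iff)

lemma orthant_add: "x \<in> orthant \<Longrightarrow> y \<in> orthant \<Longrightarrow> x + y \<in> orthant"
  by (simp add: orthant_iff)

lemma orthant_scaleR: "x \<in> orthant \<Longrightarrow> 0 \<le> c \<Longrightarrow> c *\<^sub>R x \<in> orthant"
  by (simp add: orthant_iff)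

lemma strongly_positive_in_orthant: "0 \<lless> p \<Longrightarrow> p \<in> orthant"
  by (auto simp: orthant_iff strongly_less_def less_imp_le)

lemma inner_orthant_nonneg:
  "x \<in> orthant \<Longrightarrow> y \<in> orthant \<Longrightarrow> 0 \<le> x \<bullet> (y :: real ^ 'n::finite)"
  by (auto simp: inner_vec_def orthant_iff intro!: sum_nonneg)

lemma inner_one_vec: "x \<bullet> (1 :: real ^ 'n::finite) = (\<Sum>i\<in>UNIV. x $ i)"
  by (simp add: inner_vec_def)

text \<open>The Euclidean norm is at most the sum of the coordinates, and each unit of a good costs
  at least \<open>\<delta>\<close>. This bound is behind the compactness of budget sets, the
  domination of demand, and, with \<open>p = 1\<close>, the control of a bundle by its coordinate
  sum.\<close>

lemma norm_le_inner_div: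
  fixes x :: "real ^ 'n::finite"
  assumes "x \<in> orthant" "0 < \<delta>" "\<And>i. \<delta> \<le> p $ i"
  shows "norm x \<le> (p \<bullet> x) / \<delta>"
proof -
  have "norm x \<le> (\<Sum>i\<in>UNIV. \<bar>x $ i\<bar>)" by (rule norm_le_l1_cart)
  also have "\<dots> = (\<Sum>i\<in>UNIV. x $ i)" using assms(1) by (simp add: orthant_iff)
  also have "\<dots> = (\<Sum>i\<in>UNIV. \<delta> * x $ i) / \<delta>" using assms(2) by (simp flip: sum_distrib_left)
  also have "\<dots> \<le> (p \<bullet> x) / \<delta>"
    unfolding inner_vec_def inner_real_def using assms
    by (intro divide_right_mono sum_mono mult_right_mono) (auto simp: orthant_iff)
  finally show ?thesis .
qed

lemma strongly_positive_lower_bound: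
  fixes p :: "real ^ 'n::finite"
  assumes "0 \<lless> p"
  obtains \<delta> where "\<delta> > 0" "\<And>i. \<delta> \<le> p $ i"
proof
  show "Min (range (($) p)) > 0" using assms by (simp add: strongly_less_def)
  show "\<And>i. Min (range (($) p)) \<le> p $ i" by simp
qed

lemma borel_measurable_vec_iff:
  fixes f :: "'a \<Rightarrow> real ^ 'n::finite"
  shows "f \<in> borel_measurable M \<longleftrightarrow> (\<forall>i. (\<lambda>x. f x $ i) \<in> borel_measurable M)"
proof -
  have "(\<lambda>x. f x \<bullet> axis i 1) = (\<lambda>x. f x $ i)" for i
    by (simp add: inner_axis)
  then show ?thesis
    using borel_measurable_euclidean_space[of f M] by (auto simp: Basis_vec_def)
qed

text \<open>A subsequence staying at distance \<open>e\<close> from \<open>l\<close> would, by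
  boundedness, have a convergent subsequence with another limit. For demand this turns closedness of
  the graph together with boundedness into continuity.\<close>

lemma LIMSEQ_bounded_unique_limit:
  fixes X :: "nat \<Rightarrow> 'a::heine_borel"
  assumes "bounded (range X)"
    and uniq: "\<And>r l'. strict_mono r \<Longrightarrow> (X \<circ> r) \<longlonglongrightarrow> l' \<Longrightarrow> l' = l"
  shows "X \<longlonglongrightarrow> l"
proof (rule ccontr)
  assume "\<not> X \<longlonglongrightarrow> l"
  then obtain e where e: "e > 0" "\<not> (\<forall>\<^sub>F n in sequentially. dist (X n) l < e)"
    unfolding tendsto_iff by blast
  from not_eventually_sequentiallyD[OF e(2), unfolded not_less]
  obtain r :: "nat \<Rightarrow> nat" where r: "strict_mono r" "\<forall>n. dist (X (r n)) l \<ge> e" by blast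
  have "bounded (range (X \<circ> r))" using assms(1) by (rule bounded_subset) auto
  then obtain l' s where s: "strict_mono s" "(X \<circ> r \<circ> s) \<longlonglongrightarrow> l'"
    using bounded_imp_convergent_subsequence by blast
  have "l' = l" using uniq[of "r \<circ> s" l'] s r(1) by (simp add: o_assoc strict_mono_o)
  with s(2) have "\<forall>\<^sub>F n in sequentially. dist ((X \<circ> r \<circ> s) n) l < e"
    using e(1) tendstoD by blast
  then show False using r(2) by (auto simp: eventually_sequentially not_less[symmetric])
qed

section \<open>Individual demand, its continuity and its measurability\<close>

definition regular_utility :: "(real ^ 'n::finite \<Rightarrow> real) \<Rightarrow> bool" where
  "regular_utility u \<longleftrightarrow>
     continuous_on orthant u \<and> strict_mono_on orthant u \<and> strictly_quasi_concave_on orthant u"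

definition budget :: "real ^ 'n::finite \<Rightarrow> real \<Rightarrow> (real ^ 'n) set" where
  "budget p w = {x\<in>orthant. p \<bullet> x \<le> w}"

definition best :: "(real ^ 'n::finite \<Rightarrow> real) \<Rightarrow> real ^ 'n \<Rightarrow> real \<Rightarrow> real ^ 'n \<Rightarrow> bool" where
  "best u p w x \<longleftrightarrow> x \<in> budget p w \<and> (\<forall>y\<in>budget p w. u y \<le> u x)"

text \<open>For a regular utility, strictly positive prices and nonnegative wealth the choice is the
  unique maximiser; elsewhere it may be an arbitrary value. Arguments that approach the boundary of
  the price simplex therefore use the relation \<open>best\<close>.\<close>

definition demand :: "(real ^ 'n::finite \<Rightarrow> real) \<Rightarrow> real ^ 'n \<Rightarrow> real \<Rightarrow> real ^ 'n" where
  "demand u p w = (SOME x. best u p w x)"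

lemma compact_budget:
  fixes p :: "real ^ 'n::finite"
  assumes "0 \<lless> p"
  shows "compact (budget p w)"
proof -
  obtain \<delta> where \<delta>: "\<delta> > 0" "\<And>i. \<delta> \<le> p $ i"
    using strongly_positive_lower_bound[OF assms] by blast
  have "norm x \<le> w / \<delta>" if "x \<in> budget p w" for x
    using norm_le_inner_div[of x \<delta> p] that \<delta>
    by (force simp: budget_def intro: order_trans divide_right_mono)
  then have "bounded (budget p w)" unfolding bounded_iff by blast
  moreover have "budget p w = orthant \<inter> {x. p \<bullet> x \<le> w}" by (auto simp: budget_def)
  then have "closed (budget p w)"
    by (auto intro!: closed_Int closed_orthant closed_halfspace_le)
  ultimately show ?thesis by (simp add: compact_eq_bounded_closed)
qed

lemma zero_in_budget: "0 \<le> w \<Longrightarrow> 0 \<in> budget p w"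
  by (simp add: budget_def zero_in_orthant)

lemma budget_zero_wealth:
  assumes "0 \<lless> p" "x \<in> budget p 0"
  shows "x = 0"
proof -
  obtain \<delta> where \<delta>: "\<delta> > 0" "\<And>i. \<delta> \<le> p $ i"
    using strongly_positive_lower_bound[OF assms(1)] by blast
  then have "norm x \<le> (p \<bullet> x) / \<delta>"
    using assms(2) by (intro norm_le_inner_div) (auto simp: budget_def)
  also have "\<dots> \<le> 0" using assms(2) \<delta>(1) by (simp add: budget_def divide_nonpos_pos)
  finally show ?thesis by simp
qed

text \<open>The midpoint of two distinct maximisers is affordable, and strict quasi-concavity makes
  it better than both, since they have equal utility.\<close>

lemma best_unique:
  assumes u: "regular_utility u" and x: "best u p w x" and y: "best u p w y"
  shows "x = y"
proof (rule ccontr)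
  assume ne: "x \<noteq> y"
  have o: "x \<in> orthant" "y \<in> orthant" "p \<bullet> x \<le> w" "p \<bullet> y \<le> w"
    using x y by (auto simp: best_def budget_def)
  \<comment> \<open>The second weight is written \<open>1 - 1/2\<close> to match the form in
    \<open>strictly_quasi_concave_on\<close>.\<close>
  let ?z = "(1/2) *\<^sub>R x + (1 - 1/2) *\<^sub>R y"
  have "?z \<in> budget p w"
    using o by (auto simp: budget_def inner_add_right intro!: orthant_add orthant_scaleR)
  then have "u ?z \<le> u x" "u ?z \<le> u y" using x y by (auto simp: best_def)
  moreover have "u ?z > min (u x) (u y)"
  proof -
    have "0 < (1/2 :: real)" "(1/2 :: real) < 1" by simp_all
    then show ?thesis
      using u ne o(1,2) unfolding regular_utility_def strictly_quasi_concave_on_def by blast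
  qed
  ultimately show False by linarith
qed

lemma best_demand:
  assumes u: "regular_utility u" and "0 \<lless> p" "0 \<le> w"
  shows "best u p w (demand u p w)"
proof -
  have "continuous_on (budget p w) u"
    using u by (auto simp: regular_utility_def budget_def intro: continuous_on_subset)
  then obtain x where "x \<in> budget p w" "\<forall>y\<in>budget p w. u y \<le> u x"
    using continuous_attains_sup[OF compact_budget[OF assms(2)], of w u]
      zero_in_budget[OF assms(3), of p] by blast
  then have "\<exists>x. best u p w x" by (auto simp: best_def)
  then show ?thesis unfolding demand_def by (rule someI_ex)
qed

text \<open>A bundle of the orthant costs at least 0, so affordability supplies the condition
  \<open>0 \<le> w\<close> of \<open>best_demand\<close>.\<close>

lemma best_eq_demand:
  assumes "regular_utility u" "0 \<lless> p" "best u p w x"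
  shows "x = demand u p w"
proof -
  have "0 \<le> p \<bullet> x" "p \<bullet> x \<le> w"
    using assms strongly_positive_in_orthant inner_orthant_nonneg
    by (auto simp: best_def budget_def)
  then show ?thesis using assms best_demand best_unique by fastforce
qed

lemma best_exhausts_budget:
  fixes p :: "real ^ 'n::finite"
  assumes u: "regular_utility u" and p: "0 \<lless> p" and x: "best u p w x"
  shows "p \<bullet> x = w"
proof (rule ccontr)
  assume "p \<bullet> x \<noteq> w"
  then have less: "p \<bullet> x < w" using x by (simp add: best_def budget_def)
  have c: "p \<bullet> 1 > 0"
    unfolding inner_one_vec using p by (intro sum_pos) (auto simp: strongly_less_def)
  \<comment> \<open>Adding \<open>r\<close> units of every good spends exactly the money left
    over.\<close>
  define r where "r = (w - p \<bullet> x) / (p \<bullet> 1)"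
  have r: "r > 0" using less c by (simp add: r_def)
  let ?y = "x + r *\<^sub>R 1"
  have o: "x \<in> orthant" using x by (simp add: best_def budget_def)
  have yo: "?y \<in> orthant" using o r by (auto simp: orthant_iff intro: add_nonneg_nonneg)
  have "p \<bullet> ?y = w" using c by (simp add: inner_add_right r_def)
  then have "u ?y \<le> u x" using x yo by (simp add: best_def budget_def)
  moreover have "x < ?y" using r by (simp add: less_vec_def less_eq_vec_def not_le)
  then have "u x < u ?y"
    using u o yo unfolding regular_utility_def by (blast dest: strict_mono_onD)
  ultimately show False by simp
qed

text \<open>A unit of a free good could be added at no cost and would raise utility.\<close>

lemma best_price_positive:
  fixes p :: "real ^ 'n::finite"
  assumes u: "regular_utility u" and p: "p \<in> orthant" and x: "best u p w x"
  shows "0 \<lless> p"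
proof (rule ccontr)
  assume "\<not> 0 \<lless> p"
  then obtain j where j: "p $ j = 0"
    using p by (auto simp: strongly_less_def orthant_iff not_less intro: antisym)
  let ?y = "x + axis j 1"
  have o: "x \<in> orthant" using x by (simp add: best_def budget_def)
  have yo: "?y \<in> orthant" using o by (auto simp: orthant_iff axis_def)
  have "p \<bullet> ?y = p \<bullet> x" using j by (simp add: inner_add_right inner_axis)
  then have "u ?y \<le> u x" using x yo by (simp add: best_def budget_def)
  moreover have "x < ?y"
    by (auto simp: less_vec_def less_eq_vec_def axis_def not_le intro!: exI[of _ j])
  then have "u x < u ?y"
    using u o yo unfolding regular_utility_def by (blast dest: strict_mono_onD)
  ultimately show False by simp
qed

text \<open>The limit price may have vanishing components: this is what forces equilibrium prices away
  from the boundary of the simplex.\<close>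

lemma best_limit:
  fixes p :: "real ^ 'n::finite"
  assumes u: "regular_utility u" and b: "\<And>k. best u (P k) (W k) (X k)"
    and P: "P \<longlonglongrightarrow> p" and W: "W \<longlonglongrightarrow> w" and X: "X \<longlonglongrightarrow> x" and w: "0 < w"
  shows "best u p w x"
proof -
  have cont: "continuous_on orthant u" using u by (simp add: regular_utility_def)
  have Xo: "X k \<in> orthant" for k using b[of k] by (simp add: best_def budget_def)
  have xo: "x \<in> orthant"
    by (rule Lim_in_closed_set[OF closed_orthant _ _ X]) (simp_all add: Xo)
  have "p \<bullet> x \<le> w"
    by (rule LIMSEQ_le[OF tendsto_inner[OF P X] W]) (use b in \<open>auto simp: best_def budget_def\<close>)
  moreover have "u y \<le> u x" if y: "y \<in> budget p w" for y
  proof -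
    have yo: "y \<in> orthant" using y by (simp add: budget_def)
    have uX: "(\<lambda>k. u (X k)) \<longlonglongrightarrow> u x"
      by (rule continuous_on_tendsto_compose[OF cont X xo]) (simp add: Xo)
    \<comment> \<open>A competitor affordable at the limit price may be unaffordable along the
      sequence. Because \<open>w > 0\<close>, shrinking it by \<open>c < 1\<close> makes it strictly
      cheaper than \<open>w\<close> at \<open>p\<close>, hence affordable at \<open>P k\<close> for
      all large \<open>k\<close>; then \<open>c\<close> tends to 1.\<close>
    have shrunk: "u (c *\<^sub>R y) \<le> u x" if c: "0 < c" "c < 1" for c
    proof -
      have "p \<bullet> (c *\<^sub>R y) \<le> c * w" using y c by (simp add: budget_def)
      also have "\<dots> < w" using c w by simp
      finally have "\<forall>\<^sub>F k in sequentially. P k \<bullet> (c *\<^sub>R y) < W k"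
        using order_tendstoD(1)[OF tendsto_diff[OF W tendsto_inner[OF P tendsto_const]], of 0]
        by (simp del: inner_scaleR_right)
      then have "\<forall>\<^sub>F k in sequentially. u (c *\<^sub>R y) \<le> u (X k)"
        by eventually_elim (use b yo c in \<open>auto simp: best_def budget_def orthant_scaleR\<close>)
      then show ?thesis using uX by (intro tendsto_lowerbound) auto
    qed
    have lim: "(\<lambda>n. 1 - inverse (real (Suc n))) \<longlonglongrightarrow> 1 - 0"
      by (intro tendsto_intros LIMSEQ_inverse_real_of_nat)
    have "(\<lambda>n. (1 - inverse (real (Suc n))) *\<^sub>R y) \<longlonglongrightarrow> (1 - 0) *\<^sub>R y"
      by (intro tendsto_scaleR lim tendsto_const)
    then have "(\<lambda>n. (1 - inverse (real (Suc n))) *\<^sub>R y) \<longlonglongrightarrow> y" by simp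
    then have "(\<lambda>n. u ((1 - inverse (real (Suc n))) *\<^sub>R y)) \<longlonglongrightarrow> u y"
      by (rule continuous_on_tendsto_compose[OF cont _ yo])
        (auto intro!: always_eventually orthant_scaleR yo simp: field_simps)
    \<comment> \<open>The index is shifted because the factor for \<open>n = 0\<close> is 0, while
      \<open>shrunk\<close> requires \<open>0 < c\<close>.\<close>
    then have "(\<lambda>n. u ((1 - inverse (real (Suc (Suc n)))) *\<^sub>R y)) \<longlonglongrightarrow> u y"
      by (rule LIMSEQ_Suc)
    then show ?thesis
      by (rule LIMSEQ_le_const2) (auto intro!: exI[of _ 0] shrunk simp: field_simps)
  qed
  ultimately show ?thesis using xo by (simp add: best_def budget_def)
qed

lemma demand_tendsto:
  fixes p :: "real ^ 'n::finite"
  assumes u: "regular_utility u" and p: "0 \<lless> p"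
    and P: "P \<longlonglongrightarrow> p" "\<And>k. 0 \<lless> P k" and W: "W \<longlonglongrightarrow> w" "\<And>k. 0 \<le> W k"
  shows "(\<lambda>k. demand u (P k) (W k)) \<longlonglongrightarrow> demand u p w"
proof -
  have w: "0 \<le> w" by (rule LIMSEQ_le_const[OF W(1)]) (use W(2) in auto)
  obtain \<delta> where \<delta>: "\<delta> > 0" "\<And>i. \<delta> \<le> p $ i"
    using strongly_positive_lower_bound[OF p] by blast
  have b: "best u (P k) (W k) (demand u (P k) (W k))" for k
    by (rule best_demand[OF u P(2) W(2)])
  have "\<forall>\<^sub>F k in sequentially. \<delta>/2 < P k $ i" for i
    using \<delta>(1) \<delta>(2)[of i] by (intro order_tendstoD(1)[OF tendsto_vec_nth[OF P(1)]]) linarith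
  then have "\<forall>\<^sub>F k in sequentially. \<forall>i. \<delta>/2 < P k $ i"
    by (intro eventually_all_finite)
  then have ev: "\<forall>\<^sub>F k in sequentially. norm (demand u (P k) (W k)) \<le> W k / (\<delta>/2)"
  proof eventually_elim
    case (elim k)
    have "norm (demand u (P k) (W k)) \<le> (P k \<bullet> demand u (P k) (W k)) / (\<delta>/2)"
      using b[of k] elim \<delta>(1) by (intro norm_le_inner_div) (auto simp: best_def budget_def less_imp_le)
    also have "\<dots> = W k / (\<delta>/2)" using best_exhausts_budget[OF u P(2) b] by simp
    finally show ?case .
  qed
  have lim: "(\<lambda>k. W k / (\<delta>/2)) \<longlonglongrightarrow> w / (\<delta>/2)"
    using \<delta>(1) by (intro tendsto_intros W) simp
  show ?thesis
  proof (cases "w = 0")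
    case True
    have "demand u p w = 0"
      using best_demand[OF u p w] budget_zero_wealth[OF p] True by (simp add: best_def)
    moreover have "(\<lambda>k. demand u (P k) (W k)) \<longlonglongrightarrow> 0"
      by (rule Lim_null_comparison[OF ev]) (use lim True in simp)
    ultimately show ?thesis by simp
  next
    case False
    show ?thesis
    proof (rule LIMSEQ_bounded_unique_limit)
      have "Bseq (\<lambda>k. W k / (\<delta>/2))" using lim convergentI convergent_imp_Bseq by blast
      then have "Bseq (\<lambda>k. demand u (P k) (W k))"
        by (rule Bseq_eventually_mono[rotated])
          (use ev in eventually_elim, use W(2) \<delta>(1) in simp)
      then show "bounded (range (\<lambda>k. demand u (P k) (W k)))"
        unfolding Bseq_def bounded_iff by auto
    next
      fix r :: "nat \<Rightarrow> nat" and l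
      assume r: "strict_mono r" and l: "((\<lambda>k. demand u (P k) (W k)) \<circ> r) \<longlonglongrightarrow> l"
      have "best u p w l"
        using best_limit[OF u _ LIMSEQ_subseq_LIMSEQ[OF P(1) r] LIMSEQ_subseq_LIMSEQ[OF W(1) r] l]
          b w False by simp
      then show "l = demand u p w" by (rule best_eq_demand[OF u p])
    qed
  qed
qed

text \<open>Writing the consumption of good \<open>i\<close> as \<open>w * s $ i / p $ i\<close> moves every budget set onto the
  fixed compact set of expenditure shares \<open>s\<close>.\<close>

lemma borel_measurable_demand:
  fixes p :: "'a \<Rightarrow> real ^ 'n::finite"
  assumes u: "\<And>x. x \<in> space M \<Longrightarrow> regular_utility (u x)"
    and meas: "\<And>y. y \<in> orthant \<Longrightarrow> (\<lambda>x. u x y) \<in> borel_measurable M"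
    and p: "p \<in> borel_measurable M" "\<And>x. x \<in> space M \<Longrightarrow> 0 \<lless> p x"
    and w: "w \<in> borel_measurable M" "\<And>x. x \<in> space M \<Longrightarrow> 0 \<le> w x"
  shows "(\<lambda>x. demand (u x) (p x) (w x)) \<in> borel_measurable M"
proof -
  \<comment> \<open>Shares sum to at most 1 rather than exactly 1, so that bundles leaving income
    unspent are represented as well.\<close>
  define S where "S = budget (1 :: real ^ 'n) 1"
  define g where "g x s = (\<chi> i. w x * s $ i / p x $ i)" for x and s :: "real ^ 'n"
  have one: "(0 :: real ^ 'n) \<lless> 1" by (simp add: strongly_less_def)
  have go: "g x s \<in> orthant" if "x \<in> space M" "s \<in> orthant" for x s
    using that w(2) p(2)[OF that(1)] by (auto simp: g_def orthant_iff strongly_less_def less_imp_le)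
  have gb: "g x s \<in> budget (p x) (w x)" if x: "x \<in> space M" and s: "s \<in> S" for x s
  proof -
    have "p x $ i \<noteq> 0" for i using p(2)[OF x] by (simp add: strongly_less_def less_imp_neq[symmetric])
    then have "p x \<bullet> g x s = w x * (1 \<bullet> s)"
      by (simp add: g_def inner_vec_def sum_distrib_left)
    also have "\<dots> \<le> w x * 1"
      using s w(2)[OF x] by (intro mult_left_mono) (auto simp: S_def budget_def)
    finally show ?thesis using go[OF x, of s] s by (simp add: budget_def S_def)
  qed
  have nth[measurable]: "(\<lambda>x. p x $ i) \<in> borel_measurable M" for i
    using p(1) by (simp add: borel_measurable_vec_iff)
  note w(1)[measurable]
  obtain s where s: "s \<in> borel_measurable M"
    "\<And>x. x \<in> space M \<Longrightarrow> s x \<in> S \<and> (\<forall>y\<in>S. u x (g x y) \<le> u x (g x (s x)))"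
  proof (rule measurable_maximizer[of S "\<lambda>x s. u x (g x s)" M])
    show "compact S" unfolding S_def by (rule compact_budget[OF one])
    show "S \<noteq> {}" using zero_in_budget[of 1 1] by (auto simp: S_def)
    fix y assume y: "y \<in> S"
    then have yo: "y \<in> orthant" by (simp add: S_def budget_def)
    show "(\<lambda>x. u x (g x y)) \<in> borel_measurable M"
    proof (rule borel_measurable_Caratheodory[OF meas])
      show "continuous_on orthant (u x)" if "x \<in> space M" for x
        using u[OF that] by (simp add: regular_utility_def)
      show "(\<lambda>x. g x y) \<in> borel_measurable M"
        unfolding borel_measurable_vec_iff g_def by simp
    qed (use go yo in auto)
  next
    fix x assume x: "x \<in> space M"
    have "continuous_on S (g x)"
      unfolding g_def using p(2)[OF x]
      by (intro continuous_intros) (auto simp: strongly_less_def less_imp_neq[symmetric])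
    moreover have "g x ` S \<subseteq> orthant" using go[OF x] by (auto simp: S_def budget_def)
    ultimately show "continuous_on S (\<lambda>s. u x (g x s))"
      using u[OF x] continuous_on_compose2[of orthant "u x" S "g x"]
      by (simp add: regular_utility_def)
  next
    fix s assume "s \<in> borel_measurable M"
      and "\<And>x. x \<in> space M \<Longrightarrow> s x \<in> S \<and> (\<forall>y\<in>S. u x (g x y) \<le> u x (g x (s x)))"
    then show thesis by (rule that)
  qed
  have "g x (s x) = demand (u x) (p x) (w x)" if x: "x \<in> space M" for x
  proof (rule best_eq_demand[OF u[OF x] p(2)[OF x]])
    have "u x y \<le> u x (g x (s x))" if y: "y \<in> budget (p x) (w x)" for y
    proof -
      have pos: "p x $ i > 0" for i using p(2)[OF x] by (simp add: strongly_less_def)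
      have "\<exists>t\<in>S. g x t = y"
      proof (cases "w x = 0")
        \<comment> \<open>With zero wealth the shares cannot be recovered from \<open>y\<close> by
          division; the only affordable bundle is 0, and the share vector 0 represents it.\<close>
        case True
        then have "y = 0" using y budget_zero_wealth[OF p(2)[OF x]] by simp
        then have "g x 0 = y" by (simp add: g_def vec_eq_iff)
        moreover have "0 \<in> S" by (simp add: S_def zero_in_budget)
        ultimately show ?thesis by blast
      next
        case False
        then have wp: "w x > 0" using w(2)[OF x] by simp
        let ?t = "\<chi> i. p x $ i * y $ i / w x"
        have "1 \<bullet> ?t = (p x \<bullet> y) / w x"
          by (simp add: inner_vec_def sum_divide_distrib)
        also have "\<dots> \<le> 1" using y wp by (simp add: budget_def)
        finally have "?t \<in> S"
          using y pos wp by (auto simp: S_def budget_def orthant_iff less_imp_le)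
        moreover have "g x ?t = y"
          using wp pos by (simp add: g_def vec_eq_iff less_imp_neq[symmetric])
        ultimately show ?thesis by blast
      qed
      then show ?thesis using s(2)[OF x] by blast
    qed
    then show "best (u x) (p x) (w x) (g x (s x))"
      using gb[OF x] s(2)[OF x] by (simp add: best_def)
  qed
  moreover have "(\<lambda>x. g x (s x)) \<in> borel_measurable M"
  proof -
    have [measurable]: "(\<lambda>x. s x $ i) \<in> borel_measurable M" for i
      using s(1) by (simp add: borel_measurable_vec_iff)
    show ?thesis unfolding borel_measurable_vec_iff g_def by simp
  qed
  ultimately show ?thesis by (simp cong: measurable_cong)
qed

section \<open>Walrasian equilibrium\<close>

definition truncated_simplex :: "real \<Rightarrow> (real ^ 'n::finite) set" where
  "truncated_simplex \<epsilon> = {p. (\<forall>i. \<epsilon> \<le> p $ i) \<and> (\<Sum>i\<in>UNIV. p $ i) = 1}"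

text \<open>The summand \<open>CARD('n)\<close> keeps the floor at most \<open>1 / CARD('n)\<close>,
  so the uniform price lies in every truncated simplex. The \<open>itself\<close> argument carries
  the dimension, which the type \<open>nat \<Rightarrow> real\<close> does not show.\<close>

definition price_floor :: "'n::finite itself \<Rightarrow> nat \<Rightarrow> real" where
  "price_floor _ n = 1 / (real CARD('n) + real n)"

lemma price_floor_pos: "price_floor TYPE('n::finite) n > 0"
  by (simp add: price_floor_def add_pos_nonneg)

lemma truncated_simplex_strongly_positive:
  "\<epsilon> > 0 \<Longrightarrow> p \<in> truncated_simplex \<epsilon> \<Longrightarrow> 0 \<lless> p"
  by (auto simp: truncated_simplex_def strongly_less_def intro: less_le_trans)

lemma compact_truncated_simplex:
  assumes "\<epsilon> \<ge> 0"
  shows "compact (truncated_simplex \<epsilon> :: (real ^ 'n::finite) set)"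
proof -
  have "closed (truncated_simplex \<epsilon> :: (real ^ 'n) set)"
    unfolding truncated_simplex_def
    by (intro closed_Collect_conj closed_Collect_all closed_Collect_le closed_Collect_eq
        continuous_intros)
  moreover have "compact (budget (1 :: real ^ 'n) 1)"
    by (rule compact_budget) (simp add: strongly_less_def)
  ultimately have "compact (budget (1 :: real ^ 'n) 1 \<inter> truncated_simplex \<epsilon>)"
    by (intro compact_Int_closed)
  moreover have "truncated_simplex \<epsilon> \<subseteq> budget (1 :: real ^ 'n) 1"
    using assms by (auto simp: truncated_simplex_def budget_def orthant_iff inner_vec_def
        intro: order_trans)
  ultimately show ?thesis by (simp add: Int_absorb1)
qed

lemma convex_truncated_simplex: "convex (truncated_simplex \<epsilon> :: (real ^ 'n::finite) set)"
proof (rule convexI)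
  fix x y :: "real ^ 'n" and c d :: real
  assume x: "x \<in> truncated_simplex \<epsilon>" and y: "y \<in> truncated_simplex \<epsilon>"
    and cd: "0 \<le> c" "0 \<le> d" "c + d = 1"
  have "c * \<epsilon> + d * \<epsilon> \<le> c * x $ i + d * y $ i" for i
    using x y cd by (intro add_mono mult_left_mono) (auto simp: truncated_simplex_def)
  moreover have "c * \<epsilon> + d * \<epsilon> = \<epsilon>" using cd(3) by (simp flip: distrib_right)
  moreover have "(\<Sum>i\<in>UNIV. c * x $ i + d * y $ i) = 1"
    using x y cd(3) by (simp add: truncated_simplex_def sum.distrib flip: sum_distrib_left)
  ultimately show "c *\<^sub>R x + d *\<^sub>R y \<in> truncated_simplex \<epsilon>"
    by (simp add: truncated_simplex_def)
qed

lemma uniform_price_in_truncated_simplex: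
  "(\<chi> i. 1 / real CARD('n)) \<in> (truncated_simplex (price_floor TYPE('n) n) :: (real ^ 'n::finite) set)"
  by (simp add: truncated_simplex_def price_floor_def frac_le)

text \<open>Used twice: to test the limit of the truncated problems against any interior price, and
  to find a truncated simplex containing a given equilibrium price.\<close>

lemma eventually_in_truncated_simplex:
  fixes p :: "real ^ 'n::finite"
  assumes "0 \<lless> p" "(\<Sum>i\<in>UNIV. p $ i) = 1"
  shows "\<forall>\<^sub>F n in sequentially. p \<in> truncated_simplex (price_floor TYPE('n) n)"
proof -
  have "filterlim (\<lambda>n. real CARD('n) + real n) at_top sequentially"
    by (intro filterlim_tendsto_add_at_top[OF tendsto_const] filterlim_real_sequentially)
  then have "(price_floor TYPE('n)) \<longlonglongrightarrow> 0"
    unfolding price_floor_def by (intro real_tendsto_divide_at_top[OF tendsto_const])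
  then have "\<forall>\<^sub>F n in sequentially. price_floor TYPE('n) n < p $ i" for i
    using assms(1) by (auto simp: strongly_less_def dest: order_tendstoD(2))
  then have "\<forall>\<^sub>F n in sequentially. \<forall>i. price_floor TYPE('n) n < p $ i"
    by (intro eventually_all_finite)
  then show ?thesis
    by eventually_elim (use assms(2) in \<open>auto simp: truncated_simplex_def less_imp_le\<close>)
qed

text \<open>A fixed point \<open>p\<close> of \<open>p \<mapsto> closest_point K (p + z p)\<close> solves this variational inequality.\<close>

lemma variational_inequality:
  fixes z :: "'a::euclidean_space \<Rightarrow> 'a"
  assumes K: "compact K" "convex K" "K \<noteq> {}" and z: "continuous_on K z"
  obtains p where "p \<in> K" "\<And>q. q \<in> K \<Longrightarrow> q \<bullet> z p \<le> p \<bullet> z p"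
proof -
  have cl: "closed K" using K(1) by (rule compact_imp_closed)
  obtain p where p: "p \<in> K" "closest_point K (p + z p) = p"
  proof (rule brouwer[OF K, of "\<lambda>p. closest_point K (p + z p)"])
    show "continuous_on K (\<lambda>p. closest_point K (p + z p))"
      by (rule continuous_on_compose2[OF continuous_on_closest_point[OF K(2) cl K(3), of UNIV]])
        (auto intro!: continuous_intros z)
    show "(\<lambda>p. closest_point K (p + z p)) \<in> K \<rightarrow> K"
      using closest_point_in_set[OF cl K(3)] by auto
  qed
  show thesis
  proof
    show "p \<in> K" by fact
    fix q assume "q \<in> K"
    \<comment> \<open>The obtuse-angle property of the projection, with projected point
      \<open>p\<close>, reads \<open>z p \<bullet> (q - p) \<le> 0\<close>.\<close>
    from closest_point_dot[OF K(2) cl this, of "p + z p"]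
    show "q \<bullet> z p \<le> p \<bullet> z p" unfolding p(2) by (simp add: inner_diff_right inner_commute)
  qed
qed

section \<open>Mean excess demand and equilibrium in a single state\<close>

locale exchange_economy =
  fixes M :: "'t measure" and u :: "'t \<Rightarrow> real ^ 'n::finite \<Rightarrow> real" and a :: "'t \<Rightarrow> real ^ 'n"
  assumes utility: "\<And>t. t \<in> space M \<Longrightarrow> regular_utility (u t)"
    and utility_measurable: "\<And>y. y \<in> orthant \<Longrightarrow> (\<lambda>t. u t y) \<in> borel_measurable M"
    and endowment: "\<And>t. t \<in> space M \<Longrightarrow> a t \<in> orthant"
    and endowment_integrable: "integrable M a"
    and endowment_positive: "0 \<lless> (LINT t|M. a t)"
begin

definition dem :: "real ^ 'n \<Rightarrow> 't \<Rightarrow> real ^ 'n" where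
  "dem p t = demand (u t) p (p \<bullet> a t)"

definition excess :: "real ^ 'n \<Rightarrow> real ^ 'n" where
  "excess p = (LINT t|M. dem p t) - (LINT t|M. a t)"

lemma wealth_nonneg: "0 \<lless> p \<Longrightarrow> t \<in> space M \<Longrightarrow> 0 \<le> p \<bullet> a t"
  by (intro inner_orthant_nonneg strongly_positive_in_orthant endowment)

lemma best_dem: "0 \<lless> p \<Longrightarrow> t \<in> space M \<Longrightarrow> best (u t) p (p \<bullet> a t) (dem p t)"
  unfolding dem_def by (intro best_demand utility wealth_nonneg)

lemma dem_in_orthant: "0 \<lless> p \<Longrightarrow> t \<in> space M \<Longrightarrow> dem p t \<in> orthant"
  using best_dem by (auto simp: best_def budget_def)

lemma inner_dem: "0 \<lless> p \<Longrightarrow> t \<in> space M \<Longrightarrow> p \<bullet> dem p t = p \<bullet> a t"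
  by (rule best_exhausts_budget[OF utility _ best_dem])

lemma norm_dem_le:
  assumes "t \<in> space M" "0 < \<delta>" "\<And>i. \<delta> \<le> p $ i"
  shows "norm (dem p t) \<le> norm p * norm (a t) / \<delta>"
proof -
  have p: "0 \<lless> p" using assms by (auto simp: strongly_less_def intro: less_le_trans)
  have "norm (dem p t) \<le> (p \<bullet> dem p t) / \<delta>"
    using assms dem_in_orthant[OF p] by (intro norm_le_inner_div) auto
  also have "\<dots> \<le> norm p * norm (a t) / \<delta>"
    unfolding inner_dem[OF p assms(1)] using assms(2)
    by (intro divide_right_mono norm_cauchy_schwarz) simp
  finally show ?thesis .
qed

lemma dem_measurable: "0 \<lless> p \<Longrightarrow> dem p \<in> borel_measurable M"
  unfolding dem_def using endowment_integrable
  by (intro borel_measurable_demand utility utility_measurable wealth_nonneg) auto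

lemma dem_integrable:
  assumes "0 \<lless> p"
  shows "integrable M (dem p)"
proof -
  obtain \<delta> where \<delta>: "\<delta> > 0" "\<And>i. \<delta> \<le> p $ i"
    using strongly_positive_lower_bound[OF assms] by blast
  have "integrable M (\<lambda>t. norm p * norm (a t) / \<delta>)"
    using endowment_integrable by simp
  then show ?thesis
    by (rule Bochner_Integration.integrable_bound)
      (use dem_measurable[OF assms] norm_dem_le[OF _ \<delta>] \<delta>(1) in \<open>auto intro!: AE_I2\<close>)
qed

text \<open>Walras' law: every agent exhausts the budget, and the inner product with
  \<open>p\<close> commutes with the integral.\<close>

lemma inner_excess:
  assumes "0 \<lless> p"
  shows "p \<bullet> excess p = 0"
proof -
  have "p \<bullet> (LINT t|M. dem p t) = (LINT t|M. p \<bullet> dem p t)"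
    using dem_integrable[OF assms] by simp
  also have "\<dots> = (LINT t|M. p \<bullet> a t)"
    by (intro Bochner_Integration.integral_cong) (simp_all add: inner_dem[OF assms])
  also have "\<dots> = p \<bullet> (LINT t|M. a t)" using endowment_integrable by simp
  finally show ?thesis by (simp add: excess_def inner_diff_right)
qed

lemma excess_tendsto:
  assumes p: "0 \<lless> p" and P: "P \<longlonglongrightarrow> p" "\<And>k. 0 \<lless> P k"
  shows "(\<lambda>k. excess (P k)) \<longlonglongrightarrow> excess p"
proof -
  obtain \<delta> where \<delta>: "\<delta> > 0" "\<And>i. \<delta> \<le> p $ i"
    using strongly_positive_lower_bound[OF p] by blast
  have "\<forall>\<^sub>F k in sequentially. \<delta>/2 < P k $ i" for i
    using \<delta>(1) \<delta>(2)[of i] by (intro order_tendstoD(1)[OF tendsto_vec_nth[OF P(1)]]) linarith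
  then have "\<forall>\<^sub>F k in sequentially. \<forall>i. \<delta>/2 < P k $ i"
    by (intro eventually_all_finite)
  moreover have "\<forall>\<^sub>F k in sequentially. norm (P k) < norm p + 1"
    by (intro order_tendstoD(2)[OF tendsto_norm[OF P(1)]]) simp
  ultimately have "\<forall>\<^sub>F k in sequentially. (\<forall>i. \<delta>/2 < P k $ i) \<and> norm (P k) < norm p + 1"
    by (rule eventually_conj)
  then obtain N where N: "\<And>k i. N \<le> k \<Longrightarrow> \<delta>/2 < P k $ i"
      "\<And>k. N \<le> k \<Longrightarrow> norm (P k) < norm p + 1"
    unfolding eventually_sequentially by blast
  \<comment> \<open>The integrable bound on demand holds only once the prices are close to
    \<open>p\<close>; the shift by \<open>N\<close> makes it valid for every index, as dominated
    convergence asks.\<close>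
  have "(\<lambda>k. LINT t|M. dem (P (k + N)) t) \<longlonglongrightarrow> (LINT t|M. dem p t)"
  proof (rule integral_dominated_convergence)
    show "integrable M (\<lambda>t. (norm p + 1) * norm (a t) / (\<delta>/2))"
      using endowment_integrable by simp
    have "(\<lambda>k. dem (P (k + N)) t) \<longlonglongrightarrow> dem p t" if t: "t \<in> space M" for t
      using LIMSEQ_ignore_initial_segment[OF demand_tendsto[OF utility[OF t] p P
          tendsto_inner[OF P(1) tendsto_const] wealth_nonneg[OF P(2) t]]]
      unfolding dem_def .
    then show "AE t in M. (\<lambda>k. dem (P (k + N)) t) \<longlonglongrightarrow> dem p t" by (rule AE_I2)
    have "norm (dem (P (k + N)) t) \<le> (norm p + 1) * norm (a t) / (\<delta>/2)" if t: "t \<in> space M" for t k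
    proof -
      have "norm (dem (P (k + N)) t) \<le> norm (P (k + N)) * norm (a t) / (\<delta>/2)"
        using N(1)[of "k + N"] \<delta>(1) by (intro norm_dem_le[OF t]) (auto simp: less_imp_le)
      also have "\<dots> \<le> (norm p + 1) * norm (a t) / (\<delta>/2)"
        using N(2)[of "k + N"] \<delta>(1) by (intro divide_right_mono mult_right_mono) auto
      finally show ?thesis .
    qed
    then show "AE t in M. norm (dem (P (k + N)) t) \<le> (norm p + 1) * norm (a t) / (\<delta>/2)" for k
      by (intro AE_I2)
  qed (use dem_measurable p P(2) in auto)
  then have "(\<lambda>k. LINT t|M. dem (P k) t) \<longlonglongrightarrow> (LINT t|M. dem p t)"
    by (rule LIMSEQ_offset)
  then show ?thesis unfolding excess_def by (intro tendsto_diff tendsto_const)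
qed

lemma continuous_on_excess:
  assumes "\<epsilon> > 0"
  shows "continuous_on (truncated_simplex \<epsilon>) excess"
  unfolding continuous_on_sequentially comp_def
  using excess_tendsto truncated_simplex_strongly_positive[OF assms] by blast

text \<open>If some price vanished in the limit, the demand of every agent with positive limit wealth
  would be unbounded along \<open>P\<close>; by Fatou's lemma this contradicts the bound on total demand.\<close>

lemma limit_price_positive:
  assumes P: "P \<longlonglongrightarrow> p" "\<And>k. 0 \<lless> P k" and p: "p \<in> orthant" "p \<noteq> 0"
    and bound: "\<And>k. 1 \<bullet> excess (P k) \<le> 0"
  shows "0 \<lless> p"
proof -
  let ?C = "1 \<bullet> (LINT t|M. a t)"
  have nn: "0 \<le> 1 \<bullet> dem (P k) t" if "t \<in> space M" for k t
    using dem_in_orthant[OF P(2) that] by (simp add: inner_vec_def orthant_iff sum_nonneg)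
  have total: "(\<integral>\<^sup>+ t. ennreal (1 \<bullet> dem (P k) t) \<partial>M) \<le> ennreal ?C" for k
  proof -
    have int: "integrable M (dem (P k))" by (rule dem_integrable[OF P(2)])
    have "(\<integral>\<^sup>+ t. ennreal (1 \<bullet> dem (P k) t) \<partial>M) = ennreal (LINT t|M. 1 \<bullet> dem (P k) t)"
      using int nn by (intro nn_integral_eq_integral) (auto intro: AE_I2)
    also have "\<dots> = ennreal (1 \<bullet> (LINT t|M. dem (P k) t))" using int by simp
    also have "\<dots> \<le> ennreal ?C"
      using bound[of k] by (intro ennreal_leI) (simp add: excess_def inner_diff_right)
    finally show ?thesis .
  qed
  have meas: "(\<lambda>t. ennreal (1 \<bullet> dem (P k) t)) \<in> borel_measurable M" for k
    using dem_measurable[OF P(2)] by measurable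
  have "(\<integral>\<^sup>+ t. liminf (\<lambda>k. ennreal (1 \<bullet> dem (P k) t)) \<partial>M)
      \<le> liminf (\<lambda>k. \<integral>\<^sup>+ t. ennreal (1 \<bullet> dem (P k) t) \<partial>M)"
    by (rule nn_integral_liminf[OF meas])
  also have "\<dots> \<le> liminf (\<lambda>k. ennreal ?C)"
    by (intro Liminf_mono always_eventually allI total)
  also have "\<dots> < \<infinity>" by (simp add: Liminf_const)
  finally have fin: "AE t in M. liminf (\<lambda>k. ennreal (1 \<bullet> dem (P k) t)) \<noteq> \<infinity>"
    using meas by (intro nn_integral_PInf_AE) auto
  \<comment> \<open>A single agent with positive limit wealth and demand not tending to infinity
    suffices. One exists because \<open>p \<noteq> 0\<close> and the strictly positive mean
    endowment give \<open>p\<close> a positive total value of endowments.\<close>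
  have "\<exists>t\<in>space M. liminf (\<lambda>k. ennreal (1 \<bullet> dem (P k) t)) \<noteq> \<infinity> \<and> p \<bullet> a t \<noteq> 0"
  proof (rule ccontr)
    assume *: "\<not> ?thesis"
    have "AE t in M. p \<bullet> a t = 0"
      using fin AE_space by eventually_elim (use * in blast)
    then have "(LINT t|M. p \<bullet> a t) = 0" by (rule integral_eq_zero_AE)
    then have 0: "p \<bullet> (LINT t|M. a t) = 0" using endowment_integrable by simp
    obtain j where "p $ j \<noteq> 0" using p(2) by (auto simp: vec_eq_iff)
    then have "0 < p $ j * (LINT t|M. a t) $ j"
      using p(1) endowment_positive by (auto simp: orthant_iff strongly_less_def order_less_le)
    also have "\<dots> \<le> p \<bullet> (LINT t|M. a t)"
      unfolding inner_vec_def inner_real_def using p(1) endowment_positive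
      by (intro member_le_sum) (auto simp: orthant_iff strongly_less_def less_imp_le)
    finally show False using 0 by simp
  qed
  then obtain t where t: "t \<in> space M" "liminf (\<lambda>k. ennreal (1 \<bullet> dem (P k) t)) \<noteq> \<infinity>" "p \<bullet> a t \<noteq> 0"
    by blast
  have wealth: "0 < p \<bullet> a t"
    using inner_orthant_nonneg[OF p(1) endowment[OF t(1)]] t(3) by simp
  obtain m :: nat where m: "liminf (\<lambda>k. ennreal (1 \<bullet> dem (P k) t)) < of_nat m"
    using t(2) ennreal_Ex_less_of_nat by (auto simp: top.not_eq_extremum)
  have "\<not> (\<forall>\<^sub>F k in sequentially. of_nat m \<le> ennreal (1 \<bullet> dem (P k) t))"
    using m Liminf_bounded[of "of_nat m" "\<lambda>k. ennreal (1 \<bullet> dem (P k) t)" sequentially] by auto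
  from not_eventually_sequentiallyD[OF this, unfolded not_le]
  obtain r :: "nat \<Rightarrow> nat" where r: "strict_mono r" "\<forall>k. ennreal (1 \<bullet> dem (P (r k)) t) < of_nat m"
    by blast
  have "norm (dem (P (r k)) t) \<le> real m" for k
  proof -
    have "norm (dem (P (r k)) t) \<le> 1 \<bullet> dem (P (r k)) t / 1"
      by (intro norm_le_inner_div dem_in_orthant[OF P(2) t(1)]) simp_all
    also have "\<dots> < real m"
      using r(2) nn[OF t(1)] by (simp add: ennreal_of_nat_eq_real_of_nat ennreal_less_iff)
    finally show ?thesis by simp
  qed
  then have "bounded (range (\<lambda>k. dem (P (r k)) t))" unfolding bounded_iff by blast
  then obtain x s where s: "strict_mono s" "((\<lambda>k. dem (P (r k)) t) \<circ> s) \<longlonglongrightarrow> x"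
    using bounded_imp_convergent_subsequence by blast
  have Prs: "(\<lambda>k. P (r (s k))) \<longlonglongrightarrow> p"
    using LIMSEQ_subseq_LIMSEQ[OF P(1) strict_mono_o[OF r(1) s(1)]] by (simp add: comp_def)
  \<comment> \<open>The limit bundle of this agent is optimal at \<open>p\<close>, and optimality
    excludes zero prices.\<close>
  have "best (u t) p (p \<bullet> a t) x"
    by (rule best_limit[OF utility[OF t(1)] best_dem[OF P(2) t(1)] Prs
          tendsto_inner[OF Prs tendsto_const] s(2)[unfolded comp_def] wealth])
  then show ?thesis by (rule best_price_positive[OF utility[OF t(1)] p(1)])
qed

text \<open>By Walras' law the variational inequality on a truncated simplex says that mean excess
  demand has nonpositive value at every price of that simplex. In the limit this holds for all
  interior prices, which makes each component nonpositive; Walras' law at a strictly positive price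
  then makes each component zero.\<close>

theorem equilibrium_price_exists:
  obtains p where "0 \<lless> p" "(\<Sum>i\<in>UNIV. p $ i) = 1" "excess p = 0"
proof -
  let ?K = "\<lambda>n. truncated_simplex (price_floor TYPE('n) n) :: (real ^ 'n) set"
  have "\<exists>p\<in>?K n. \<forall>q\<in>?K n. q \<bullet> excess p \<le> 0" for n
  proof -
    obtain p where p: "p \<in> ?K n" "\<And>q. q \<in> ?K n \<Longrightarrow> q \<bullet> excess p \<le> p \<bullet> excess p"
      using variational_inequality[OF compact_truncated_simplex convex_truncated_simplex _
          continuous_on_excess, of "price_floor TYPE('n) n"]
        uniform_price_in_truncated_simplex[where 'n='n] price_floor_pos[where 'n='n]
      by (metis empty_iff less_imp_le)
    then show ?thesis
      using inner_excess truncated_simplex_strongly_positive[OF price_floor_pos] by metis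
  qed
  then obtain P where P: "\<And>n. P n \<in> ?K n" "\<And>n q. q \<in> ?K n \<Longrightarrow> q \<bullet> excess (P n) \<le> 0"
    by metis
  have Ppos: "0 \<lless> P n" for n using P(1) truncated_simplex_strongly_positive[OF price_floor_pos] by blast
  have bound: "1 \<bullet> excess (P n) \<le> 0" for n
  proof -
    \<comment> \<open>The uniform price belongs to every truncated simplex; as a test price it
      bounds the sum of the components of excess demand, which is what
      \<open>limit_price_positive\<close> needs.\<close>
    have "(\<chi> i. 1 / real CARD('n)) \<bullet> excess (P n) = (1 \<bullet> excess (P n)) / real CARD('n)"
      by (simp add: inner_vec_def sum_divide_distrib)
    then have "(1 \<bullet> excess (P n)) / real CARD('n) \<le> 0"
      using P(2)[OF uniform_price_in_truncated_simplex, of n] by simp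
    then show ?thesis by (simp add: divide_le_0_iff)
  qed
  have "P n \<in> truncated_simplex 0" for n
    using P(1)[of n] price_floor_pos[where 'n='n and n=n]
    by (auto simp: truncated_simplex_def intro: order_trans less_imp_le)
  then obtain p r where p: "p \<in> truncated_simplex 0" and r: "strict_mono r" "(P \<circ> r) \<longlonglongrightarrow> p"
    using compact_truncated_simplex[of 0] unfolding compact_def by (metis order_refl)
  have po: "p \<in> orthant" and sum1: "(\<Sum>i\<in>UNIV. p $ i) = 1"
    using p by (auto simp: truncated_simplex_def orthant_iff)
  then have "p \<noteq> 0" by auto
  then have pos: "0 \<lless> p"
    using limit_price_positive[OF r(2) _ po] Ppos bound by simp
  have lim: "(\<lambda>n. excess ((P \<circ> r) n)) \<longlonglongrightarrow> excess p"
    by (rule excess_tendsto[OF pos r(2)]) (simp add: Ppos)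
  have dual: "q \<bullet> excess p \<le> 0" if q: "0 \<lless> q" "(\<Sum>i\<in>UNIV. q $ i) = 1" for q
  proof -
    have "\<forall>\<^sub>F n in sequentially. q \<in> ?K (r n)"
      using eventually_subseq[OF r(1) eventually_in_truncated_simplex[OF q]] .
    then have "\<forall>\<^sub>F n in sequentially. q \<bullet> excess ((P \<circ> r) n) \<le> 0"
      by eventually_elim (simp add: P(2))
    then show ?thesis
      by (intro tendsto_upperbound[OF tendsto_inner[OF tendsto_const lim]]) auto
  qed
  have le: "excess p $ j \<le> 0" for j
  proof -
    \<comment> \<open>A vertex of the simplex is in general not strictly positive, so it is averaged
      with \<open>p\<close>; by Walras' law the half coming from \<open>p\<close> contributes
      nothing.\<close>
    let ?q = "(1/2) *\<^sub>R p + (1/2) *\<^sub>R axis j 1"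
    have "0 \<lless> ?q" using pos by (auto simp: strongly_less_def axis_def intro: add_pos_nonneg)
    moreover have "(\<Sum>i\<in>UNIV. ?q $ i) = 1"
      using sum1 by (simp add: sum.distrib axis_def flip: sum_divide_distrib)
    ultimately have "?q \<bullet> excess p \<le> 0" by (rule dual)
    then show ?thesis
      using inner_excess[OF pos] by (simp add: inner_add_left inner_axis')
  qed
  have "(\<Sum>i\<in>UNIV. - (p $ i * excess p $ i)) = 0"
    using inner_excess[OF pos] by (simp add: inner_vec_def sum_negf)
  then have "\<forall>i\<in>UNIV. - (p $ i * excess p $ i) = 0"
    using le pos by (subst (asm) sum_nonneg_eq_0_iff)
      (auto simp: strongly_less_def less_imp_le mult_nonneg_nonpos)
  then have "excess p = 0"
    using pos by (auto simp: vec_eq_iff strongly_less_def less_imp_neq[symmetric])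
  then show thesis using that pos sum1 by blast
qed

text \<open>A bundle preferred to demand costs more than the endowment. On a blocking coalition the
  extra cost \<open>h\<close> would thus be positive almost everywhere, while equality of the two
  integrals over \<open>S\<close> gives it integral zero, so \<open>S\<close> would be null.\<close>

lemma equilibrium_in_core:
  assumes p: "0 \<lless> p" and eq: "excess p = 0"
  shows "dem p \<in> ci_core \<lparr>ci_agents = M, ci_util = u, ci_endow = a\<rparr>"
proof -
  have False
    if S: "coalition M S" and g: "\<forall>t\<in>space M. g t \<in> orthant" "integrable M g"
      and budget: "(LINT t:S|M. g t) = (LINT t:S|M. a t)"
      and better: "AE t in M. t \<in> S \<longrightarrow> u t (dem p t) < u t (g t)" for S g
  proof -
    have Sm: "S \<in> sets M" using S by (simp add: coalition_def)
    define h where "h t = indicat_real S t * (p \<bullet> g t - p \<bullet> a t)" for t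
    have expensive: "AE t in M. t \<in> S \<longrightarrow> p \<bullet> a t < p \<bullet> g t"
      using better AE_space
    proof eventually_elim
      case (elim t)
      then show ?case using best_dem[OF p, of t] g(1)
        by (fastforce simp: best_def budget_def not_less)
    qed
    have int: "integrable M (\<lambda>t. indicat_real S t *\<^sub>R g t)" "integrable M (\<lambda>t. indicat_real S t *\<^sub>R a t)"
      using integrable_mult_indicator[OF Sm] g(2) endowment_integrable by auto
    have h: "h = (\<lambda>t. p \<bullet> (indicat_real S t *\<^sub>R g t) - p \<bullet> (indicat_real S t *\<^sub>R a t))"
      by (auto simp: h_def algebra_simps)
    have hint: "integrable M h" unfolding h
      by (intro Bochner_Integration.integrable_diff integrable_inner_right int)
    have "(LINT t|M. h t) = p \<bullet> (LINT t:S|M. g t) - p \<bullet> (LINT t:S|M. a t)"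
      unfolding h set_lebesgue_integral_def
      by (simp only: Bochner_Integration.integral_diff[OF integrable_inner_right integrable_inner_right]
          integral_inner_right int)
    then have "(LINT t|M. h t) = 0" using budget by simp
    moreover have "AE t in M. 0 \<le> h t"
      using expensive by eventually_elim (auto simp: h_def indicator_def)
    ultimately have "AE t in M. h t = 0"
      using integral_nonneg_eq_0_iff_AE[OF hint] by simp
    then have "AE t in M. t \<notin> S"
      using expensive by eventually_elim (auto simp: h_def)
    then have "emeasure M S = 0" using Sm by (simp add: AE_iff_null_sets null_setsD1)
    then show False using S by (simp add: coalition_def)
  qed
  moreover have "(LINT t|M. dem p t) = (LINT t|M. a t)" using eq by (simp add: excess_def)
  ultimately show ?thesis
    using dem_in_orthant[OF p] dem_integrable[OF p]
    unfolding ci_core_def ci_assignment_def mem_Collect_eq ci_economy.simps by blast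
qed

end

section \<open>Measurable equilibrium prices\<close>

lemma regular_utility_util:
  assumes "A3 E" "A4 E" "t \<in> space (agents E)" "\<omega> \<in> space (states E)"
  shows "regular_utility (util E t \<omega>)"
  using assms by (simp add: A3_def A4_def regular_utility_def)

lemma exchange_economy_at:
  fixes E :: "('t, 'w, 'n::finite) economy"
  assumes E: "is_economy E" "A1 E" "A2 E" "A3 E" "A4 E" and \<omega>: "\<omega> \<in> space (states E)"
  shows "exchange_economy (agents E) (\<lambda>t. util E t \<omega>) (\<lambda>t. endow E t \<omega>)"
proof
  show "regular_utility (util E t \<omega>)" if "t \<in> space (agents E)" for t
    using regular_utility_util[OF E(4,5) that \<omega>] .
  show "(\<lambda>t. util E t \<omega> y) \<in> borel_measurable (agents E)" if "y \<in> orthant" for y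
    using E(3) that measurable_Pair1[OF _ \<omega>, of "\<lambda>(t, \<omega>). util E t \<omega> y" "agents E" borel]
    by (simp add: A2_def)
qed (use E(1,2) \<omega> in \<open>auto simp: is_economy_def A1_def\<close>)

text \<open>Demand at a fixed price is jointly measurable in state and agent, so integrating out the
  agent leaves a measurable function of the state. The pair is ordered \<open>(\<omega>, t)\<close>
  because the integral theorem integrates over the second coordinate.\<close>

lemma excess_measurable_in_state:
  fixes E :: "('t, 'w, 'n::finite) economy"
  assumes E: "is_economy E" "A1 E" "A2 E" "A3 E" "A4 E" and p: "0 \<lless> p"
  shows "(\<lambda>\<omega>. exchange_economy.excess (agents E) (\<lambda>t. util E t \<omega>) (\<lambda>t. endow E t \<omega>) p)
    \<in> borel_measurable (states E)" (is "?z \<in> _")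
proof -
  interpret finite_measure "agents E" using E(1) by (simp add: is_economy_def)
  have a: "(\<lambda>(\<omega>, t). endow E t \<omega>) \<in> borel_measurable (states E \<Otimes>\<^sub>M agents E)"
    using E(2) measurable_pair_swap by (fastforce simp: A1_def)
  have "(\<lambda>x. demand (case x of (\<omega>, t) \<Rightarrow> util E t \<omega>) p (p \<bullet> (case x of (\<omega>, t) \<Rightarrow> endow E t \<omega>)))
      \<in> borel_measurable (states E \<Otimes>\<^sub>M agents E)"
  proof (rule borel_measurable_demand)
    fix y :: "real ^ 'n" assume "y \<in> orthant"
    then have "(\<lambda>(t, \<omega>). util E t \<omega> y) \<in> borel_measurable (agents E \<Otimes>\<^sub>M states E)"
      using E(3) by (simp add: A2_def)
    from measurable_pair_swap[OF this]
    show "(\<lambda>x. (case x of (\<omega>, t) \<Rightarrow> util E t \<omega>) y) \<in> borel_measurable (states E \<Otimes>\<^sub>M agents E)"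
      by (simp add: case_prod_beta')
  next
    fix x assume x: "x \<in> space (states E \<Otimes>\<^sub>M agents E)"
    then show "regular_utility (case x of (\<omega>, t) \<Rightarrow> util E t \<omega>)"
      using regular_utility_util[OF E(4,5)] by (auto simp: space_pair_measure)
    show "0 \<le> p \<bullet> (case x of (\<omega>, t) \<Rightarrow> endow E t \<omega>)"
      using x E(1) inner_orthant_nonneg[OF strongly_positive_in_orthant[OF p]]
      by (auto simp: space_pair_measure is_economy_def)
  qed (use a p in auto)
  then have "(\<lambda>(\<omega>, t). demand (util E t \<omega>) p (p \<bullet> endow E t \<omega>))
      \<in> borel_measurable (states E \<Otimes>\<^sub>M agents E)"
    by (simp add: case_prod_beta')
  from borel_measurable_lebesgue_integral[OF this] borel_measurable_lebesgue_integral[OF a]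
  have "(\<lambda>\<omega>. (LINT t|agents E. demand (util E t \<omega>) p (p \<bullet> endow E t \<omega>))
      - (LINT t|agents E. endow E t \<omega>)) \<in> borel_measurable (states E)"
    by (rule borel_measurable_diff)
  moreover have "?z \<omega> = (LINT t|agents E. demand (util E t \<omega>) p (p \<bullet> endow E t \<omega>))
      - (LINT t|agents E. endow E t \<omega>)" if "\<omega> \<in> space (states E)" for \<omega>
  proof -
    interpret exchange_economy "agents E" "\<lambda>t. util E t \<omega>" "\<lambda>t. endow E t \<omega>"
      by (rule exchange_economy_at[OF E that])
    show ?thesis by (simp add: excess_def dem_def)
  qed
  ultimately show ?thesis by (simp cong: measurable_cong)
qed

text \<open>A given truncated simplex need not contain an equilibrium price of the state, so zeros
  cannot be selected from it directly. Minimisers of the norm of excess demand always exist there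
  and can be selected measurably; they are zeros as soon as the simplex contains one.\<close>

lemma measurable_equilibrium_price:
  fixes E :: "('t, 'w, 'n::finite) economy"
  assumes E: "is_economy E" "A1 E" "A2 E" "A3 E" "A4 E"
  obtains p :: "'w \<Rightarrow> real ^ 'n" where "p \<in> borel_measurable (states E)"
    and "\<And>\<omega>. \<omega> \<in> space (states E) \<Longrightarrow> 0 \<lless> p \<omega> \<and>
      exchange_economy.excess (agents E) (\<lambda>t. util E t \<omega>) (\<lambda>t. endow E t \<omega>) (p \<omega>) = 0"
proof -
  let ?K = "\<lambda>n. truncated_simplex (price_floor TYPE('n) n) :: (real ^ 'n) set"
  define z where "z \<omega> = exchange_economy.excess (agents E) (\<lambda>t. util E t \<omega>) (\<lambda>t. endow E t \<omega>)" for \<omega>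
  have Kpos: "p \<in> ?K n \<Longrightarrow> 0 \<lless> p" for p n
    by (rule truncated_simplex_strongly_positive[OF price_floor_pos])
  have zm: "(\<lambda>\<omega>. z \<omega> p) \<in> borel_measurable (states E)" if "p \<in> ?K n" for p n
    unfolding z_def by (rule excess_measurable_in_state[OF E Kpos[OF that]])
  have zc: "continuous_on (?K n) (z \<omega>)" if "\<omega> \<in> space (states E)" for \<omega> n
    unfolding z_def
    by (rule exchange_economy.continuous_on_excess[OF exchange_economy_at[OF E that] price_floor_pos])
  have "\<exists>q. q \<in> borel_measurable (states E) \<and> (\<forall>\<omega>\<in>space (states E).
      q \<omega> \<in> ?K n \<and> (\<forall>p\<in>?K n. - norm (z \<omega> p) \<le> - norm (z \<omega> (q \<omega>))))" for n
  proof (rule measurable_maximizer[of "?K n" "\<lambda>\<omega> p. - norm (z \<omega> p)" "states E"])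
    show "compact (?K n)" by (rule compact_truncated_simplex[OF less_imp_le[OF price_floor_pos]])
    show "?K n \<noteq> {}" using uniform_price_in_truncated_simplex by blast
    show "(\<lambda>\<omega>. - norm (z \<omega> p)) \<in> borel_measurable (states E)" if "p \<in> ?K n" for p
      using zm[OF that] by measurable
    show "continuous_on (?K n) (\<lambda>p. - norm (z \<omega> p))" if "\<omega> \<in> space (states E)" for \<omega>
      by (intro continuous_intros zc that)
  qed blast
  then obtain q where q[measurable]: "\<And>n. q n \<in> borel_measurable (states E)"
    and qK: "\<And>n \<omega>. \<omega> \<in> space (states E) \<Longrightarrow> q n \<omega> \<in> ?K n"
    and qmin: "\<And>n \<omega> p. \<omega> \<in> space (states E) \<Longrightarrow> p \<in> ?K n \<Longrightarrow> norm (z \<omega> (q n \<omega>)) \<le> norm (z \<omega> p)"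
    by (simp only: neg_le_iff_le) metis
  have [measurable]: "(\<lambda>\<omega>. z \<omega> (q n \<omega>)) \<in> borel_measurable (states E)" for n
    by (rule borel_measurable_Caratheodory[OF zm zc q qK])
  \<comment> \<open>The first simplex whose minimiser is a zero. In every state such an index
    exists, because each normalised strictly positive price lies in some truncated simplex.\<close>
  define N where "N \<omega> = (LEAST n. z \<omega> (q n \<omega>) = 0)" for \<omega>
  have [measurable]: "N \<in> measurable (states E) (count_space UNIV)"
    unfolding N_def by measurable
  show thesis
  proof
    show "(\<lambda>\<omega>. q (N \<omega>) \<omega>) \<in> borel_measurable (states E)"
      by (rule measurable_compose_countable) auto
    fix \<omega> assume \<omega>: "\<omega> \<in> space (states E)"
    interpret exchange_economy "agents E" "\<lambda>t. util E t \<omega>" "\<lambda>t. endow E t \<omega>"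
      by (rule exchange_economy_at[OF E \<omega>])
    obtain p where p: "0 \<lless> p" "(\<Sum>i\<in>UNIV. p $ i) = 1" "z \<omega> p = 0"
      using equilibrium_price_exists unfolding z_def by metis
    obtain n where "p \<in> ?K n"
      using eventually_in_truncated_simplex[OF p(1,2)] by (auto simp: eventually_sequentially)
    then have "z \<omega> (q n \<omega>) = 0" using qmin[OF \<omega>, of p n] p(3) by simp
    then have "z \<omega> (q (N \<omega>) \<omega>) = 0" unfolding N_def by (rule LeastI)
    then show "0 \<lless> q (N \<omega>) \<omega> \<and> excess (q (N \<omega>) \<omega>) = 0"
      using Kpos[OF qK[OF \<omega>]] unfolding z_def by blast
  qed
qed

section \<open>Assembling the states, and the two descriptions of the ex-post core\<close>

lemma ci_core_feasible:
  "f \<in> ci_core D \<Longrightarrow> ci_assignment D f \<and> (LINT t|ci_agents D. f t) = (LINT t|ci_agents D. ci_endow D t)"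
  unfolding ci_core_def mem_Collect_eq by (elim conjE) (rule conjI)

theorem allocation_of_state_cores_exists:
  fixes E :: "('t, 'w, 'n::finite) economy"
  assumes E: "is_economy E" "A1 E" "A2 E" "A3 E" "A4 E"
  shows "\<exists>f. allocation E f \<and> (\<forall>\<omega>\<in>space (states E). (\<lambda>t. f t \<omega>) \<in> ci_core (economy_at E \<omega>))"
proof -
  obtain p :: "'w \<Rightarrow> real ^ 'n" where p: "p \<in> borel_measurable (states E)"
    and eq: "\<And>\<omega>. \<omega> \<in> space (states E) \<Longrightarrow> 0 \<lless> p \<omega> \<and>
      exchange_economy.excess (agents E) (\<lambda>t. util E t \<omega>) (\<lambda>t. endow E t \<omega>) (p \<omega>) = 0"
    using measurable_equilibrium_price[OF E] by blast
  define f where "f t \<omega> = demand (util E t \<omega>) (p \<omega>) (p \<omega> \<bullet> endow E t \<omega>)" for t \<omega>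
  have core: "(\<lambda>t. f t \<omega>) \<in> ci_core (economy_at E \<omega>)" if \<omega>: "\<omega> \<in> space (states E)" for \<omega>
  proof -
    interpret exchange_economy "agents E" "\<lambda>t. util E t \<omega>" "\<lambda>t. endow E t \<omega>"
      by (rule exchange_economy_at[OF E \<omega>])
    show ?thesis
      using equilibrium_in_core[of "p \<omega>"] eq[OF \<omega>]
      unfolding f_def economy_at_def dem_def by blast
  qed
  \<comment> \<open>The agent is now fixed and the state varies: sections of the jointly measurable
    data, together with the measurable price, make demand measurable in the state.\<close>
  have "f t \<in> borel_measurable (states E)" if t: "t \<in> space (agents E)" for t
    unfolding f_def
  proof (rule borel_measurable_demand[OF regular_utility_util[OF E(4,5) t] _ p])
    show "(\<lambda>\<omega>. util E t \<omega> y) \<in> borel_measurable (states E)" if "y \<in> orthant" for y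
      using E(3) that measurable_Pair2[OF _ t, of "\<lambda>(t, \<omega>). util E t \<omega> y" "states E" borel]
      by (simp add: A2_def)
    have "(\<lambda>\<omega>. endow E t \<omega>) \<in> borel_measurable (states E)"
      using E(2) measurable_Pair2[OF _ t, of "\<lambda>(t, \<omega>). endow E t \<omega>" "states E" borel]
      by (simp add: A1_def)
    then show "(\<lambda>\<omega>. p \<omega> \<bullet> endow E t \<omega>) \<in> borel_measurable (states E)"
      by (intro borel_measurable_inner p)
    show "0 \<le> p \<omega> \<bullet> endow E t \<omega>" if "\<omega> \<in> space (states E)" for \<omega>
      by (rule inner_orthant_nonneg[OF strongly_positive_in_orthant])
        (use that t E(1) eq in \<open>auto simp: is_economy_def\<close>)
  qed (use eq in auto)
  \<comment> \<open>Integrability and market clearing in each state are read off from membership in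
    the core of that state.\<close>
  moreover have "(\<forall>t\<in>space (agents E). f t \<omega> \<in> orthant) \<and> integrable (agents E) (\<lambda>t. f t \<omega>) \<and>
      (LINT t|agents E. f t \<omega>) = (LINT t|agents E. endow E t \<omega>)"
    if "\<omega> \<in> space (states E)" for \<omega>
    using ci_core_feasible[OF core[OF that]] by (simp add: ci_assignment_def economy_at_def)
  ultimately have "allocation E f"
    unfolding allocation_def assignment_def by blast
  then show ?thesis using core by blast
qed

text \<open>A complete-information assignment blocking in one state extends constantly to all states.\<close>

lemma ex_post_blocked_iff:
  assumes "assignment E f"
  shows "ex_post_blocked E f S \<longleftrightarrow> (\<exists>\<omega>\<in>space (states E). \<exists>g. ci_assignment (economy_at E \<omega>) g \<and>
     (LINT t:S|agents E. g t) = (LINT t:S|agents E. endow E t \<omega>) \<and>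
     (AE t in agents E. t \<in> S \<longrightarrow> util E t \<omega> (g t) > util E t \<omega> (f t \<omega>)))" (is "_ \<longleftrightarrow> ?R")
proof
  assume "ex_post_blocked E f S"
  then obtain \<omega> g where "\<omega> \<in> space (states E)" "assignment E g"
    "(LINT t:S|agents E. g t \<omega>) = (LINT t:S|agents E. endow E t \<omega>)"
    "AE t in agents E. t \<in> S \<longrightarrow> util E t \<omega> (g t \<omega>) > util E t \<omega> (f t \<omega>)"
    unfolding ex_post_blocked_def by blast
  then show ?R
    by (intro bexI[of _ \<omega>] exI[of _ "\<lambda>t. g t \<omega>"])
      (auto simp: assignment_def ci_assignment_def economy_at_def)
next
  assume ?R
  then obtain \<omega> g where "\<omega> \<in> space (states E)" "ci_assignment (economy_at E \<omega>) g"
    "(LINT t:S|agents E. g t) = (LINT t:S|agents E. endow E t \<omega>)"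
    "AE t in agents E. t \<in> S \<longrightarrow> util E t \<omega> (g t) > util E t \<omega> (f t \<omega>)"
    by blast
  then show "ex_post_blocked E f S"
    unfolding ex_post_blocked_def
    by (intro bexI[of _ \<omega>] exI[of _ "\<lambda>t _. g t"])
      (auto simp: assignment_def ci_assignment_def economy_at_def)
qed

text \<open>An allocation is feasible in every state, so only blocking has to be compared. By
  \<open>ex_post_blocked_iff\<close> this amounts to exchanging the quantifiers over coalitions and
  states.\<close>

lemma ex_post_core_eq:
  "ex_post_core E = {f. allocation E f \<and>
     (\<forall>\<omega>\<in>space (states E). (\<lambda>t. f t \<omega>) \<in> ci_core (economy_at E \<omega>))}"
proof -
  have "(\<nexists>S. coalition (agents E) S \<and> ex_post_blocked E f S) \<longleftrightarrow>
      (\<forall>\<omega>\<in>space (states E). (\<lambda>t. f t \<omega>) \<in> ci_core (economy_at E \<omega>))"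
    if f: "allocation E f" for f
  proof -
    have as: "assignment E f" using f by (simp add: allocation_def)
    have ag: "ci_agents (economy_at E \<omega>) = agents E" "ci_util (economy_at E \<omega>) = (\<lambda>t. util E t \<omega>)"
      "ci_endow (economy_at E \<omega>) = (\<lambda>t. endow E t \<omega>)" for \<omega>
      by (simp_all add: economy_at_def)
    have "ci_assignment (economy_at E \<omega>) (\<lambda>t. f t \<omega>)"
      "(LINT t|agents E. f t \<omega>) = (LINT t|agents E. endow E t \<omega>)"
      if "\<omega> \<in> space (states E)" for \<omega>
      using f that by (auto simp: allocation_def assignment_def ci_assignment_def economy_at_def)
    then show ?thesis
      unfolding ex_post_blocked_iff[OF as] ci_core_def mem_Collect_eq ag by blast
  qed
  then show ?thesis unfolding ex_post_core_def by blast
qed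

theorem theorem3p2:
  fixes E :: "('t, 'w, 'n::finite) economy"
  assumes "is_economy E" and "A1 E" and "A2 E" and "A3 E" and "A4 E"
  shows "ex_post_core E \<noteq> {} \<and>
    ex_post_core E =
      {f. allocation E f \<and>
          (\<forall>\<omega>\<in>space (states E). (\<lambda>t. f t \<omega>) \<in> ci_core (economy_at E \<omega>))}"
proof
  obtain f where "allocation E f \<and>
      (\<forall>\<omega>\<in>space (states E). (\<lambda>t. f t \<omega>) \<in> ci_core (economy_at E \<omega>))"
    using allocation_of_state_cores_exists[OF assms] by (elim exE)
  then have "f \<in> ex_post_core E" by (simp add: ex_post_core_eq)
  then show "ex_post_core E \<noteq> {}" by blast
qed (rule ex_post_core_eq)

end
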